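(* Let $\varepsilon>0$ and assume $n\in\Omega(\varepsilon^{-4})$ is sufficiently large. For any $r\in\Omega(n^{1/3})$, there exists an algorithm that, for the problem of maximizing a monotone submodular function $f$ under the cardinality constraint $\mathcal{I}(r)=\{S\subseteq N:|S|\le r\}$ given only the noisy value oracle $\tilde f$, returns a $\left(1-\frac1e-O(\varepsilon)\right)$-approximation with probability $1-O\left(\frac1{n^2}\right)$, using at most $O(n^6\varepsilon^{-1})$ queries to $\tilde f$.
   Context: $N$ is a ground set with $|N|=n$. $f:2^N\to\mathbb{R}_{\ge0}$ is monotone, submodular and $f(\varnothing)=0$. A noise distribution $\mathcal{D}$ has a generalized exponential tail if there is $x_0$ such that for every $x>x_0$ its density is $\rho(x)=e^{-g(x)}$ with $g(x)=\sum_i c_ix^{\gamma_i}$ for reals $\gamma_0\ge\gamma_1\ge\cdots$ with $\gamma_0\ge1$, $c_0>0$; if $\mathcal{D}$ has bounded support it is only required that it has an atom at its supremum or that $\rho$ is continuous and nonzero there. It is assumed $\mathbb{E}[\mathcal{D}]=1$. The noisy value oracle satisfies $\tilde f(S)=\xi_Sf(S)$ for every $S\subseteq N$, with $\xi_S$ i.i.d. from $\mathcal{D}$ (one draw per set). The algorithm accesses $f$ only through $\tilde f$. A $\beta$-approximation is a feasible $S$ with $f(S)\ge\beta\max_{T\in\mathcal{I}(r)}f(T)$. *)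

theory Defs
  imports "HOL-Probability.Probability"
begin

definition monotone_submodular :: "'a set \<Rightarrow> ('a set \<Rightarrow> real) \<Rightarrow> bool" where
  "monotone_submodular N f \<longleftrightarrow>
     f {} = 0 \<and>
     (\<forall>S. S \<subseteq> N \<longrightarrow> 0 \<le> f S) \<and>
     (\<forall>S T. S \<subseteq> T \<longrightarrow> T \<subseteq> N \<longrightarrow> f S \<le> f T) \<and>
     (\<forall>S T. S \<subseteq> N \<longrightarrow> T \<subseteq> N \<longrightarrow> f (S \<union> T) + f (S \<inter> T) \<le> f S + f T)"

definition card_constraint :: "'a set \<Rightarrow> nat \<Rightarrow> 'a set set" where
  "card_constraint N r = {S. S \<subseteq> N \<and> card S \<le> r}"

definition is_approximation ::
  "real \<Rightarrow> 'a set set \<Rightarrow> ('a set \<Rightarrow> real) \<Rightarrow> 'a set \<Rightarrow> bool" where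
  "is_approximation \<beta> \<I> f S \<longleftrightarrow> S \<in> \<I> \<and> \<beta> * Max (f ` \<I>) \<le> f S"

definition measure_support :: "real measure \<Rightarrow> real set" where
  "measure_support D = {x. \<forall>U. open U \<longrightarrow> x \<in> U \<longrightarrow> 0 < emeasure D U}"

text \<open>The part of \<open>D\<close> inside \<open>I\<close> has Lebesgue density \<open>\<rho>\<close>; nothing is said about \<open>D\<close>
  outside \<open>I\<close>.\<close>

definition has_density_on :: "real measure \<Rightarrow> real set \<Rightarrow> (real \<Rightarrow> real) \<Rightarrow> bool" where
  "has_density_on D I \<rho> \<longleftrightarrow>
     set_borel_measurable borel I \<rho> \<and>
     (\<forall>x\<in>I. 0 \<le> \<rho> x) \<and>
     (\<forall>A\<in>sets borel. A \<subseteq> I \<longrightarrow> emeasure D A = (\<integral>\<^sup>+x\<in>A. ennreal (\<rho> x) \<partial>lborel))"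

text \<open>A finite sum in the exponent is the case where \<open>c\<close> vanishes from some index on. Requiring
  \<open>0 \<le> x0\<close> is no restriction, since \<open>x0\<close> may be enlarged; it keeps the real powers meaningful.
  At the supremum of a bounded support the density is zero to the right, so continuity is
  one-sided.\<close>

definition generalized_exponential_tail :: "real measure \<Rightarrow> bool" where
  "generalized_exponential_tail D \<longleftrightarrow>
     (if bounded (measure_support D) then
        (let s = Sup (measure_support D) in
           0 < emeasure D {s} \<or>
           (\<exists>\<delta> \<rho>. 0 < \<delta> \<and> has_density_on D {s - \<delta><..s} \<rho> \<and>
                  continuous (at s within {..s}) \<rho> \<and> \<rho> s \<noteq> 0))
      else
        (\<exists>x0 g c \<gamma>. 0 \<le> x0 \<and>
           (\<forall>i j :: nat. i \<le> j \<longrightarrow> \<gamma> j \<le> \<gamma> i) \<and> 1 \<le> \<gamma> 0 \<and> 0 < c 0 \<and>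
           (\<forall>x>x0. (\<lambda>i. c i * x powr \<gamma> i) sums g x) \<and>
           has_density_on D {x0<..} (\<lambda>x. exp (- g x))))"

definition noise_distribution :: "real measure \<Rightarrow> bool" where
  "noise_distribution D \<longleftrightarrow>
     prob_space D \<and> sets D = sets borel \<and> generalized_exponential_tail D \<and>
     integrable D (\<lambda>x. x) \<and> (LINT x|D. x) = 1"

text \<open>The joint law of the multipliers \<open>\<xi> S\<close>, independent and one for each \<open>S \<subseteq> N\<close>.\<close>

definition noise_space :: "'a set \<Rightarrow> real measure \<Rightarrow> ('a set \<Rightarrow> real) measure" where
  "noise_space N D = (\<Pi>\<^sub>M S\<in>Pow N. D)"

definition noisy_oracle :: "('a set \<Rightarrow> real) \<Rightarrow> ('a set \<Rightarrow> real) \<Rightarrow> 'a set \<Rightarrow> real" where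
  "noisy_oracle \<xi> f S = \<xi> S * f S"

text \<open>A deterministic adaptive query algorithm: it either stops with an output set, or queries
  the value of a set and continues depending on the answer.\<close>

datatype 'a query_alg = Return "'a set" | Query "'a set" "real \<Rightarrow> 'a query_alg"

primrec alg_output :: "'a query_alg \<Rightarrow> ('a set \<Rightarrow> real) \<Rightarrow> 'a set" where
  "alg_output (Return S) v = S"
| "alg_output (Query S k) v = alg_output (k (v S)) v"

primrec alg_queries :: "'a query_alg \<Rightarrow> ('a set \<Rightarrow> real) \<Rightarrow> 'a set list" where
  "alg_queries (Return S) v = []"
| "alg_queries (Query S k) v = S # alg_queries (k (v S)) v"

definition query_bounded :: "'a set \<Rightarrow> real \<Rightarrow> 'a query_alg \<Rightarrow> bool" where
  "query_bounded N q A \<longleftrightarrow>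
     (\<forall>v. set (alg_queries A v) \<subseteq> Pow N \<and> real (length (alg_queries A v)) \<le> q)"

text \<open>Continuations of a \<open>Query\<close> are arbitrary functions on the reals, hence measurability of the
  event is demanded explicitly.\<close>

definition holds_with_prob :: "'b measure \<Rightarrow> real \<Rightarrow> ('b \<Rightarrow> bool) \<Rightarrow> bool" where
  "holds_with_prob M p P \<longleftrightarrow>
     {x \<in> space M. P x} \<in> sets M \<and> p \<le> measure M {x \<in> space M. P x}"

end

theory Submission
  imports Defs "HOL-Library.Discrete_Functions" "HOL-Real_Asymp.Real_Asymp"
begin

text \<open>Fix a set \<open>H\<close> of about \<open>4 log n\<close> elements and average the positive parts of the noisy values of
  \<open>T \<union> X\<close> over all \<open>X \<subseteq> H\<close>. Up to the constant factor \<open>\<mu> = E max(0, \<xi>) \<ge> 1\<close> this estimates the mean of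
  \<open>f (T \<union> X)\<close>, again a monotone submodular function of \<open>T\<close>, from about \<open>n\<^sup>4\<close> independent samples;
  since \<open>max(0, \<xi>)\<close> has finite moments of all orders, truncation and Hoeffding's inequality give
  additive error \<open>\<epsilon> OPT / n\<close> with failure probability far below any needed power of \<open>n\<close>. Greedy on
  the estimate with \<open>r - |H|\<close> steps asks only fresh queries in each step, so adaptivity does no harm,
  and returning the greedy set together with \<open>H\<close> loses only \<open>|H| / r \<le> \<epsilon>\<close>. The optimum may
  overlap \<open>H\<close>, but among \<open>\<lceil>1/\<epsilon>\<rceil>\<close> disjoint choices of \<open>H\<close> one costs the optimum at most
  an \<open>\<epsilon>\<close> fraction of its value, and the best run is recognised by its own estimate.\<close>

section \<open>Moments of the positive part of the noise\<close>

text \<open>The algorithm does not know the noise law, so \<open>\<mu>\<close> cannot be divided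
  out. It only compares estimates, and \<open>\<mu> \<ge> 1\<close> keeps additive errors from
  growing when \<open>\<mu>\<close> is undone. The exponents fit as follows. The hypothesis on n
  forces \<epsilon> to be at least of order n^(-1/4). With error \<epsilon> OPT / n per comparison,
  at most n greedy steps lose O(\<epsilon>) OPT. With truncation at sqrt n and about n^4 samples,
  the Hoeffding exponent is of order n^4 (\<epsilon>/n)^2 / n, hence at least of order sqrt n. About
  1/\<epsilon> runs of at most n steps, with at most n candidates each and n^4 queries per
  candidate, give n^6/\<epsilon>. A block must be small against \<epsilon> r; as r is at least of
  order n^(1/3), this is at least of order n^(1/12) and beats log n. The analytic obstacle is that
  the exponent of the density is given only as a pointwise convergent series whose leading terms may
  cancel. Its growth is therefore settled by a dichotomy, one side of which contradicts finite total
  mass.\<close>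

text \<open>Summation by parts: the partial sums of \<open>a\<close> get multiplied by the
  nonnegative differences \<open>w i - w (Suc i)\<close>, which together with \<open>w n\<close>
  telescope to \<open>w 0\<close>. Only bounded partial sums are needed, so conditionally convergent
  series are covered.\<close>

lemma abel_inequality:
  fixes a w :: "nat \<Rightarrow> real"
  assumes a: "\<And>n. \<bar>\<Sum>i<n. a i\<bar> \<le> C" and w: "antimono w" "\<And>i. 0 \<le> w i"
  shows "\<bar>\<Sum>i<n. a i * w i\<bar> \<le> C * w 0"
proof -
  define A where "A n = (\<Sum>i<n. a i)" for n
  have parts: "(\<Sum>i<n. a i * w i) = A n * w n + (\<Sum>i<n. A (Suc i) * (w i - w (Suc i)))" for n
    by (induction n) (simp_all add: A_def algebra_simps)
  have "\<bar>\<Sum>i<n. a i * w i\<bar> \<le> \<bar>A n\<bar> * w n + (\<Sum>i<n. \<bar>A (Suc i)\<bar> * (w i - w (Suc i)))"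
    unfolding parts
    by (rule order.trans[OF abs_triangle_ineq add_mono], simp add: abs_mult w,
        rule order.trans[OF sum_abs])
       (auto intro!: sum_mono simp: abs_mult antimonoD[OF w(1)])
  also have "\<dots> \<le> C * w n + (\<Sum>i<n. C * (w i - w (Suc i)))"
    using a w unfolding A_def by (intro add_mono sum_mono mult_right_mono) (auto simp del: sum.lessThan_Suc simp: antimonoD[OF w(1)])
  also have "\<dots> = C * w 0"
    by (simp only: sum_distrib_left[symmetric] sum_lessThan_telescope') (simp add: algebra_simps)
  finally show ?thesis .
qed

text \<open>Convergence at the single point \<open>x1\<close> controls all larger \<open>x\<close>:
  \<open>x powr \<gamma> i\<close> is \<open>x1 powr \<gamma> i\<close> times
  \<open>(x / x1) powr \<gamma> i\<close>, and as \<open>x / x1 \<ge> 1\<close> the second factor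
  decreases in \<open>i\<close> and can serve as the weight in Abel's inequality.\<close>

lemma decreasing_powers_remainder_bound:
  fixes c \<gamma> :: "nat \<Rightarrow> real"
  assumes x1: "0 < x1" and \<gamma>: "antimono \<gamma>" and conv: "summable (\<lambda>i. c i * x1 powr \<gamma> i)"
  shows "\<exists>C. \<forall>x\<ge>x1. \<forall>n. \<bar>\<Sum>i<n. c (i + l) * x powr \<gamma> (i + l)\<bar> \<le> C * x powr \<gamma> l"
proof -
  define a where "a i = c (i + l) * x1 powr \<gamma> (i + l)" for i
  have "summable a"
    unfolding a_def using conv by (rule summable_ignore_initial_segment)
  then have "Bseq (\<lambda>n. \<Sum>i<n. a i)"
    by (intro convergent_imp_Bseq) (simp add: summable_iff_convergent)
  then obtain C where C: "\<bar>\<Sum>i<n. a i\<bar> \<le> C" for n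
    by (auto simp: Bseq_def)
  have "\<bar>\<Sum>i<n. c (i + l) * x powr \<gamma> (i + l)\<bar> \<le> C / x1 powr \<gamma> l * x powr \<gamma> l"
    if x: "x1 \<le> x" for x n
  proof -
    have "\<bar>\<Sum>i<n. a i * (x / x1) powr \<gamma> (i + l)\<bar> \<le> C * (x / x1) powr \<gamma> (0 + l)"
    proof (rule abel_inequality[OF C])
      show "antimono (\<lambda>i. (x / x1) powr \<gamma> (i + l))"
        using x x1 \<gamma> by (auto intro!: antimonoI powr_mono simp: antimono_def)
    qed auto
    moreover have "a i * (x / x1) powr \<gamma> (i + l) = c (i + l) * x powr \<gamma> (i + l)" for i
      using x x1 by (simp add: a_def powr_divide)
    ultimately show ?thesis
      using x x1 by (simp add: powr_divide)
  qed
  then show ?thesis by blast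
qed

text \<open>Terms with equal exponents may cancel, so \<open>\<gamma> 0\<close> need not be the order of growth of the sum;
  the dichotomy comes from the first group of equal exponents whose coefficients do not cancel.\<close>

lemma decreasing_powers_dichotomy:
  fixes c \<gamma> g :: "_ \<Rightarrow> real"
  assumes x0: "0 \<le> x0" and \<gamma>: "antimono \<gamma>"
    and g: "\<And>x. x0 < x \<Longrightarrow> (\<lambda>i. c i * x powr \<gamma> i) sums g x"
  shows "(\<exists>K. \<forall>\<^sub>F x in at_top. g x \<le> K) \<or> (\<exists>b>0. \<exists>d>0. \<forall>\<^sub>F x in at_top. b * x powr d \<le> g x)"
proof -
  define x1 where "x1 = x0 + 1"
  have x1: "0 < x1" "x0 < x1" using x0 by (auto simp: x1_def)
  define P where "P k x = (\<Sum>i<k. c i * x powr \<gamma> i)" for k x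
  have P_lim: "(\<lambda>k. P k x) \<longlonglongrightarrow> g x" if "x0 < x" for x
    using g[OF that] by (simp add: sums_def P_def)
  have ev: "\<forall>\<^sub>F x in at_top. x1 \<le> x" by (rule eventually_ge_at_top)
  \<comment> \<open>\<open>Z\<close> collects the lengths of initial segments that cancel
    completely. If there are infinitely many, a subsequence of the partial sums is zero and so is
    \<open>g\<close>; otherwise the term after the longest such segment starts the group that
    decides the growth.\<close>
  define Z where "Z = {k. \<forall>x>x0. P k x = 0}"
  consider "infinite Z" | "finite Z" by blast
  then show ?thesis
  proof cases
    case 1
    have "g x = 0" if "x0 < x" for x
    proof -
      have "(\<lambda>k. P (enumerate Z k) x) \<longlonglongrightarrow> g x"
        using LIMSEQ_subseq_LIMSEQ[OF P_lim[OF that] strict_mono_enumerate[OF 1]]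
        by (simp add: o_def)
      moreover have "P (enumerate Z k) x = 0" for k
        using enumerate_in_set[OF 1, of k] that by (auto simp: Z_def)
      ultimately show ?thesis
        by (simp add: LIMSEQ_const_iff)
    qed
    then have "\<forall>\<^sub>F x in at_top. g x \<le> 0"
      by (intro eventually_mono[OF eventually_gt_at_top[of x0]]) simp
    then show ?thesis by blast
  next
    case 2
    define k where "k = Max Z"
    have "0 \<in> Z" by (simp add: Z_def P_def)
    then have k: "k \<in> Z"
      unfolding k_def using 2 by (intro Max_in) auto
    have k_max: "\<And>j. j \<in> Z \<Longrightarrow> j \<le> k"
      using 2 by (simp add: k_def)
    have P_split: "P (n + k) x = (\<Sum>i<n. c (i + k) * x powr \<gamma> (i + k))" if "x0 < x" for n x
      using k that sum.atLeastLessThan_concat[of 0 k "n + k" "\<lambda>i. c i * x powr \<gamma> i"]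
        sum.shift_bounds_nat_ivl[of "\<lambda>i. c i * x powr \<gamma> i" 0 k n]
      by (simp add: P_def Z_def atLeast0LessThan)
    define e where "e = \<gamma> k"
    \<comment> \<open>\<open>s\<close> is the sum of the coefficients with exponent \<open>e\<close>
      from index \<open>k\<close> on. If this group is finite, \<open>s \<noteq> 0\<close>, as
      otherwise a longer segment would cancel. If all remaining exponents equal \<open>e\<close>,
      then \<open>s\<close> may be 0 but there is no remainder; hence the clause
      \<open>s = 0 \<longrightarrow> C = 0\<close>.\<close>
    have "\<exists>s e' C. e' < e \<and> (s = 0 \<longrightarrow> C = 0) \<and> (\<forall>x\<ge>x1. \<bar>g x - s * x powr e\<bar> \<le> C * x powr e')"
    proof (cases "\<exists>l>k. \<gamma> l < e")
      case True
      define l where "l = (LEAST l. k < l \<and> \<gamma> l < e)"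
      have l: "k < l" "\<gamma> l < e" using LeastI_ex[OF True] by (auto simp: l_def)
      have eq: "\<gamma> i = e" if "k \<le> i" "i < l" for i
        using not_less_Least[of i "\<lambda>l. k < l \<and> \<gamma> l < e"] that antimonoD[OF \<gamma> that(1)]
        by (cases "i = k") (auto simp: l_def e_def)
      define s where "s = (\<Sum>i<l - k. c (i + k))"
      have Pl: "P l x = s * x powr e" if "x0 < x" for x
      proof -
        have "P l x = (\<Sum>i<l - k. c (i + k) * x powr \<gamma> (i + k))"
          using P_split[OF that, of "l - k"] l by simp
        also have "\<dots> = (\<Sum>i<l - k. c (i + k) * x powr e)"
          by (intro sum.cong) (auto simp: eq)
        finally show ?thesis by (simp add: s_def sum_distrib_right)
      qed
      obtain C where C: "\<bar>\<Sum>i<n. c (i + l) * x powr \<gamma> (i + l)\<bar> \<le> C * x powr \<gamma> l"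
        if "x1 \<le> x" for x n
        using decreasing_powers_remainder_bound[OF x1(1) \<gamma> sums_summable[OF g[OF x1(2)]], of l]
        by blast
      have "\<bar>g x - s * x powr e\<bar> \<le> C * x powr \<gamma> l" if x: "x1 \<le> x" for x
      proof (rule LIMSEQ_le_const2)
        have "x0 < x" using x x1 by simp
        from P_lim[OF this] have "(\<lambda>n. P (n + l) x) \<longlonglongrightarrow> g x"
          by (rule LIMSEQ_ignore_initial_segment)
        then show "(\<lambda>n. \<bar>P (n + l) x - s * x powr e\<bar>) \<longlonglongrightarrow> \<bar>g x - s * x powr e\<bar>"
          by (intro tendsto_intros)
        have "P (n + l) x - s * x powr e = (\<Sum>i<n. c (i + l) * x powr \<gamma> (i + l))" for n
          using Pl[OF \<open>x0 < x\<close>] sum.atLeastLessThan_concat[of 0 l "n + l" "\<lambda>i. c i * x powr \<gamma> i"]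
            sum.shift_bounds_nat_ivl[of "\<lambda>i. c i * x powr \<gamma> i" 0 l n]
          by (simp add: P_def atLeast0LessThan)
        then show "\<exists>N. \<forall>n\<ge>N. \<bar>P (n + l) x - s * x powr e\<bar> \<le> C * x powr \<gamma> l"
          using C[OF x] by simp
      qed
      moreover have "s \<noteq> 0"
      proof
        assume "s = 0"
        then have "l \<in> Z" by (simp add: Z_def Pl)
        then show False using k_max l(1) by fastforce
      qed
      ultimately show ?thesis using l by blast
    next
      case False
      have eq: "\<gamma> (i + k) = e" for i
      proof (cases "i = 0")
        case i: False
        then have "k < i + k" by simp
        then have "\<not> \<gamma> (i + k) < e" using False by blast
        moreover have "\<gamma> (i + k) \<le> e" using antimonoD[OF \<gamma>, of k "i + k"] by (simp add: e_def)
        ultimately show ?thesis by linarith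
      qed (simp add: e_def)
      have "(\<lambda>i. c (i + k) * x powr e) sums g x" if "x0 < x" for x
        using LIMSEQ_ignore_initial_segment[OF P_lim[OF that], of k] P_split[OF that]
        by (simp add: sums_def eq)
      note sums = this
      have "(\<lambda>i. c (i + k)) sums (g x1 / x1 powr e)"
        using sums_divide[OF sums[OF x1(2)], of "x1 powr e"] x1 by simp
      note s_sums = this
      define s where "s = g x1 / x1 powr e"
      have "g x = s * x powr e" if "x0 < x" for x
        unfolding s_def by (rule sums_unique2[OF sums[OF that] sums_mult2[OF s_sums]])
      then have "\<forall>x\<ge>x1. \<bar>g x - s * x powr e\<bar> \<le> 0 * x powr (e - 1)"
        using x1 by simp
      then show ?thesis by (intro exI[of _ s] exI[of _ "e - 1"] exI[of _ 0]) auto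
    qed
    then obtain s e' C where e': "e' < e" and s: "s = 0 \<longrightarrow> C = 0"
      and C: "\<And>x. x1 \<le> x \<Longrightarrow> \<bar>g x - s * x powr e\<bar> \<le> C * x powr e'"
      by blast
    have up: "\<forall>\<^sub>F x in at_top. g x \<le> s * x powr e + C * x powr e'"
      and low: "\<forall>\<^sub>F x in at_top. s * x powr e - C * x powr e' \<le> g x"
      by (rule eventually_mono[OF ev], drule C, linarith)+
    show ?thesis
    proof (cases "0 < s \<and> 0 < e")
      case True
      then have "\<forall>\<^sub>F x in at_top. s / 2 * x powr e \<le> s * x powr e - C * x powr e'"
        using e' by real_asymp
      with low have "\<forall>\<^sub>F x in at_top. s / 2 * x powr e \<le> g x"
        by eventually_elim simp
      then show ?thesis using True by (intro disjI2 exI[of _ "s / 2"] exI[of _ e]) auto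
    next
      case False
      have "\<exists>K. \<forall>\<^sub>F x in at_top. s * x powr e + C * x powr e' \<le> K"
      proof (cases "0 < e")
        case True
        with False consider "s = 0" | "s < 0" by linarith
        then show ?thesis
        proof cases
          case 1
          then show ?thesis using s by (intro exI[of _ 0]) simp
        next
          case 2
          then have "\<forall>\<^sub>F x in at_top. s * x powr e + C * x powr e' \<le> 0"
            using e' True by real_asymp
          then show ?thesis by blast
        qed
      next
        case False
        then have "\<forall>\<^sub>F x in at_top. s * x powr e + C * x powr e' \<le> \<bar>s\<bar> + \<bar>C\<bar>"
        proof -
          have "s * x powr e + C * x powr e' \<le> \<bar>s\<bar> * 1 + \<bar>C\<bar> * 1" if "1 \<le> x" for x
          proof (intro add_mono)
            have "x powr e \<le> 1" "x powr e' \<le> 1"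
              using False e' that powr_mono[of e 0 x] powr_mono[of e' 0 x] by auto
            then show "s * x powr e \<le> \<bar>s\<bar> * 1" "C * x powr e' \<le> \<bar>C\<bar> * 1"
              by (intro mult_mono; simp)+
          qed
          then show ?thesis by (intro eventually_mono[OF eventually_ge_at_top[of 1]]) simp
        qed
        then show ?thesis by blast
      qed
      then obtain K where "\<forall>\<^sub>F x in at_top. s * x powr e + C * x powr e' \<le> K" by blast
      with up have "\<forall>\<^sub>F x in at_top. g x \<le> K" by eventually_elim simp
      then show ?thesis by blast
    qed
  qed
qed

section \<open>From the tail condition to finite moments\<close>

text \<open>The complement of the support is a union of open null sets, which Lindelof's theorem
  reduces to a countable union.\<close>

lemma AE_in_measure_support:
  fixes D :: "real measure"
  assumes D: "sets D = sets borel"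
  shows "AE x in D. x \<in> measure_support D"
proof -
  define F where "F = {U :: real set. open U \<and> emeasure D U = 0}"
  obtain F' where F': "F' \<subseteq> F" "countable F'" "\<Union>F' = \<Union>F"
    by (rule Lindelof[of F]) (auto simp: F_def)
  have "\<Union>F' \<in> null_sets D"
  proof -
    have "(\<Union>U\<in>F'. U) \<in> null_sets D"
      using F' D by (intro null_sets_UN') (auto simp: F_def null_sets_def)
    then show ?thesis by simp
  qed
  moreover have "- measure_support D \<subseteq> \<Union>F"
    by (auto simp: F_def measure_support_def zero_less_iff_neq_zero)
  ultimately show ?thesis
    using F' D by (intro AE_I'[of "\<Union>F'"]) auto
qed

text \<open>\<open>has_density_on\<close> speaks of sets only. It makes the restrictions of the two
  measures to \<open>I\<close> equal, and equal measures have equal integrals.\<close>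

lemma nn_integral_has_density_on:
  assumes D: "sets D = sets borel" and dens: "has_density_on D I \<rho>" and I: "I \<in> sets borel"
    and h: "h \<in> borel_measurable borel"
  shows "(\<integral>\<^sup>+x\<in>I. h x \<partial>D) = (\<integral>\<^sup>+x\<in>I. ennreal (\<rho> x) * h x \<partial>lborel)"
proof -
  have [measurable]: "(\<lambda>x. ennreal (\<rho> x) * indicator I x) \<in> borel_measurable borel"
  proof -
    have "(\<lambda>x. ennreal (indicator I x *\<^sub>R \<rho> x)) \<in> borel_measurable borel"
      using dens by (intro measurable_compose[OF _ measurable_ennreal])
        (simp add: has_density_on_def set_borel_measurable_def)
    also have "(\<lambda>x. ennreal (indicator I x *\<^sub>R \<rho> x)) = (\<lambda>x. ennreal (\<rho> x) * indicator I x)"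
      by (auto simp: indicator_def)
    finally show ?thesis .
  qed
  note [measurable_cong] = D
  note [measurable] = I h
  have "density D (indicator I) = density lborel (\<lambda>x. ennreal (\<rho> x) * indicator I x)"
  proof (rule measure_eqI)
    fix A assume "A \<in> sets (density D (indicator I))"
    then have [measurable]: "A \<in> sets borel" by (simp add: D)
    have "emeasure (density D (indicator I)) A = emeasure D (A \<inter> I)"
      by (subst emeasure_density) (auto simp: D indicator_inter_arith[symmetric] Int_commute)
    also have "\<dots> = (\<integral>\<^sup>+x. ennreal (\<rho> x) * indicator (A \<inter> I) x \<partial>lborel)"
      using dens by (auto simp: has_density_on_def)
    also have "\<dots> = emeasure (density lborel (\<lambda>x. ennreal (\<rho> x) * indicator I x)) A"
      by (subst emeasure_density, measurable) (auto intro!: nn_integral_cong simp: indicator_def)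
    finally show "emeasure (density D (indicator I)) A =
      emeasure (density lborel (\<lambda>x. ennreal (\<rho> x) * indicator I x)) A" .
  qed (simp add: D)
  then have "(\<integral>\<^sup>+x. h x \<partial>density D (indicator I)) =
      (\<integral>\<^sup>+x. h x \<partial>density lborel (\<lambda>x. ennreal (\<rho> x) * indicator I x))"
    by simp
  then show ?thesis
    by (subst (asm) (1 2) nn_integral_density) (auto simp: mult_ac)
qed

text \<open>For bounded support, \<open>max 0 x\<close> is almost surely bounded. Otherwise, if
  \<open>g\<close> were eventually bounded above, the density \<open>exp (- g x)\<close> would stay
  above a positive constant on a half-line and have infinite mass. So \<open>g\<close> dominates a
  positive power of \<open>x\<close>, and \<open>exp (- g x) * x ^ k\<close> eventually lies below
  \<open>1 / x ^ 2\<close>.\<close>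

lemma noise_upper_moment:
  assumes noise: "noise_distribution D"
  shows "integrable D (\<lambda>x. (max 0 x) ^ k)"
proof -
  interpret prob_space D using noise by (simp add: noise_distribution_def)
  have D: "sets D = sets borel" and tail: "generalized_exponential_tail D"
    using noise by (auto simp: noise_distribution_def)
  note [measurable_cong] = D
  show ?thesis
  proof (cases "bounded (measure_support D)")
    case True
    then obtain B where B: "\<And>x. x \<in> measure_support D \<Longrightarrow> \<bar>x\<bar> \<le> B"
      by (auto simp: bounded_iff)
    show ?thesis
    proof (rule integrable_const_bound[where B = "(max 0 B) ^ k"])
      show "AE x in D. norm (max 0 x ^ k) \<le> max 0 B ^ k"
        using AE_in_measure_support[OF D]
      proof eventually_elim
        case (elim x)
        then show ?case using B[OF elim] by (auto intro!: power_mono)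
      qed
    qed simp
  next
    case False
    with tail obtain x0 g c \<gamma> where x0: "0 \<le> x0"
      and \<gamma>: "\<forall>i j :: nat. i \<le> j \<longrightarrow> \<gamma> j \<le> \<gamma> i"
      and g: "\<forall>x>x0. (\<lambda>i. c i * x powr \<gamma> i) sums g x"
      and dens: "has_density_on D {x0<..} (\<lambda>x. exp (- g x))"
      by (auto simp: generalized_exponential_tail_def)
    have dens': "has_density_on D {y<..} (\<lambda>x. exp (- g x))" if y: "x0 \<le> y" for y
    proof -
      have "(\<lambda>x. indicator {y<..} x *\<^sub>R (indicator {x0<..} x *\<^sub>R exp (- g x))) \<in> borel_measurable borel"
        using dens unfolding has_density_on_def set_borel_measurable_def
        by (elim conjE) (rule borel_measurable_scaleR[OF borel_measurable_indicator], simp, assumption)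
      also have "(\<lambda>x. indicator {y<..} x *\<^sub>R (indicator {x0<..} x *\<^sub>R exp (- g x))) =
          (\<lambda>x. indicator {y<..} x *\<^sub>R exp (- g x))"
        using y by (auto simp: indicator_def)
      finally have "set_borel_measurable borel {y<..} (\<lambda>x. exp (- g x))"
        by (simp add: set_borel_measurable_def)
      moreover have "A \<subseteq> {x0<..}" if "A \<subseteq> {y<..}" for A
        using that y by auto
      ultimately show ?thesis
        using dens by (auto simp: has_density_on_def)
    qed
    from decreasing_powers_dichotomy[of x0 \<gamma> c g] x0 \<gamma> g
    consider (bdd) K where "\<forall>\<^sub>F x in at_top. g x \<le> K"
      | (grows) b d where "0 < b" "0 < d" "\<forall>\<^sub>F x in at_top. b * x powr d \<le> g x"
      by (auto simp: antimono_def)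
    then show ?thesis
    proof cases
      case bdd
      then obtain y' where "\<And>x. y' \<le> x \<Longrightarrow> g x \<le> K"
        by (auto simp: eventually_at_top_linorder)
      then obtain y where y: "x0 \<le> y" "\<And>x. y < x \<Longrightarrow> g x \<le> K"
        using that[of "max x0 y'"] by auto
      have "emeasure lborel {y<..} = \<top>"
      proof (rule ccontr)
        assume "emeasure lborel {y<..} \<noteq> \<top>"
        then obtain a where a: "emeasure lborel {y<..} = ennreal a" "0 \<le> a"
          by (cases "emeasure lborel {y<..}") auto
        have "emeasure lborel {y<..y + (a + 1)} \<le> emeasure lborel {y<..}"
          by (intro emeasure_mono) auto
        then show False using a by simp
      qed
      then have "\<infinity> = (\<integral>\<^sup>+x. ennreal (exp (- K)) * indicator {y<..} x \<partial>lborel)"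
        by (subst nn_integral_cmult_indicator) (auto simp: ennreal_mult_top)
      also have "\<dots> \<le> (\<integral>\<^sup>+x\<in>{y<..}. ennreal (exp (- g x)) \<partial>lborel)"
        by (intro nn_integral_mono) (auto simp: indicator_def y)
      also have "\<dots> = emeasure D {y<..}"
        using dens'[OF y(1)] by (simp add: has_density_on_def)
      finally show ?thesis
        by (simp add: emeasure_eq_measure top_unique)
    next
      case (grows b d)
      have "\<forall>\<^sub>F x in at_top. exp (- (b * x powr d)) * x ^ k \<le> 1 / x ^ 2"
      proof -
        have "((\<lambda>x. exp (- (b * x powr d)) * x powr (real k + 2)) \<longlongrightarrow> 0) at_top"
          using grows(1,2) by real_asymp
        then have "\<forall>\<^sub>F x in at_top. exp (- (b * x powr d)) * x powr (real k + 2) < 1"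
          by (rule order_tendstoD) simp
        then show ?thesis
          using eventually_gt_at_top[of 0]
          by eventually_elim (simp add: powr_add powr_realpow field_simps)
      qed
      with grows(3) have "\<forall>\<^sub>F x in at_top. exp (- g x) * x ^ k \<le> 1 / x ^ 2"
        using eventually_gt_at_top[of 0]
      proof eventually_elim
        case (elim x)
        have "exp (- g x) * x ^ k \<le> exp (- (b * x powr d)) * x ^ k"
          using elim by (intro mult_right_mono) auto
        with elim show ?case by linarith
      qed
      then obtain y' where "\<And>x. y' \<le> x \<Longrightarrow> exp (- g x) * x ^ k \<le> 1 / x ^ 2"
        by (auto simp: eventually_at_top_linorder)
      then obtain y where y: "x0 + 1 \<le> y" "\<And>x. y \<le> x \<Longrightarrow> exp (- g x) * x ^ k \<le> 1 / x ^ 2"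
        using that[of "max (x0 + 1) y'"] by auto
      have y1: "x0 \<le> y" "0 < y" using x0 y(1) by auto
      have "(\<integral>\<^sup>+x\<in>{y<..}. ennreal ((max 0 x) ^ k) \<partial>D) =
          (\<integral>\<^sup>+x\<in>{y<..}. ennreal (exp (- g x)) * ennreal ((max 0 x) ^ k) \<partial>lborel)"
        by (intro nn_integral_has_density_on D dens' y1) auto
      also have "\<dots> \<le> (\<integral>\<^sup>+x. ennreal (1 / x ^ 2) * indicator {y..} x \<partial>lborel)"
        using y y1 by (intro nn_integral_mono)
          (auto simp: indicator_def ennreal_mult[symmetric] intro!: ennreal_leI)
      also have "\<dots> = ennreal (0 - (- (1 / y)))"
      proof (rule nn_integral_FTC_atLeast)
        show "((\<lambda>x::real. - (1 / x)) \<longlongrightarrow> 0) at_top" by real_asymp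
        show "((\<lambda>x. - (1 / x)) has_real_derivative 1 / x ^ 2) (at x)" if "y \<le> x" for x
          using that y1 by (auto intro!: derivative_eq_intros simp: field_simps power2_eq_square)
      qed auto
      finally have tail_fin: "(\<integral>\<^sup>+x\<in>{y<..}. ennreal ((max 0 x) ^ k) \<partial>D) < \<infinity>"
        by (rule order.strict_trans1) simp
      show ?thesis
      proof (rule integrableI_bounded)
        have "(\<integral>\<^sup>+x. ennreal (norm (max 0 x ^ k)) \<partial>D) \<le>
            (\<integral>\<^sup>+x. ennreal (y ^ k) + ennreal ((max 0 x) ^ k) * indicator {y<..} x \<partial>D)"
          using y1 by (intro nn_integral_mono) (auto simp: indicator_def not_less intro!: ennreal_leI power_mono)
        also have "\<dots> = ennreal (y ^ k) + (\<integral>\<^sup>+x\<in>{y<..}. ennreal ((max 0 x) ^ k) \<partial>D)"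
          by (subst nn_integral_add) (auto simp: emeasure_space_1)
        also have "\<dots> < \<infinity>"
          using tail_fin by (simp add: ennreal_add_less_top)
        finally show "(\<integral>\<^sup>+x. ennreal (norm (max 0 x ^ k)) \<partial>D) < \<infinity>" .
      qed simp
    qed
  qed
qed

section \<open>Concentration and independence in the product space\<close>

lemma indep_vars_PiM_coordinates:
  assumes I: "I \<noteq> {}" and M: "\<And>i. i \<in> I \<Longrightarrow> prob_space (M i)"
  shows "prob_space.indep_vars (PiM I M) M (\<lambda>i \<omega>. \<omega> i) I"
proof -
  interpret P: prob_space "PiM I M" using M by (rule prob_space_PiM)
  have "distr (PiM I M) (PiM I M) (\<lambda>\<omega>. \<lambda>i\<in>I. \<omega> i) = distr (PiM I M) (PiM I M) (\<lambda>\<omega>. \<omega>)"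
    by (intro distr_cong) (auto simp: space_PiM)
  also have "\<dots> = PiM I (\<lambda>i. distr (PiM I M) (M i) (\<lambda>\<omega>. \<omega> i))"
    using M by (auto simp: distr_PiM_component intro!: PiM_cong)
  finally show ?thesis
    by (subst P.indep_vars_iff_distr_eq_PiM'[OF I]) auto
qed

text \<open>\<open>depU\<close> and \<open>depV\<close> are pointwise conditions, whereas
  independence of the restrictions needs events of the subproducts. For an event determined by the
  coordinates in \<open>C\<close>, such an event is its preimage under the measurable map
  \<open>e\<close>, which fills the coordinates outside \<open>C\<close> from a fixed point
  \<open>d\<close>.\<close>

lemma measure_PiM_Int_disjoint_coordinates:
  assumes I: "I \<noteq> {}" and M: "\<And>i. i \<in> I \<Longrightarrow> prob_space (M i)"
    and AB: "A \<inter> B = {}" "A \<subseteq> I" "B \<subseteq> I"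
    and U: "U \<in> sets (PiM I M)" and V: "V \<in> sets (PiM I M)"
    and depU: "\<And>\<omega> \<omega>'. \<omega> \<in> U \<Longrightarrow> \<omega>' \<in> space (PiM I M) \<Longrightarrow> (\<And>i. i \<in> A \<Longrightarrow> \<omega> i = \<omega>' i) \<Longrightarrow> \<omega>' \<in> U"
    and depV: "\<And>\<omega> \<omega>'. \<omega> \<in> V \<Longrightarrow> \<omega>' \<in> space (PiM I M) \<Longrightarrow> (\<And>i. i \<in> B \<Longrightarrow> \<omega> i = \<omega>' i) \<Longrightarrow> \<omega>' \<in> V"
  shows "measure (PiM I M) (U \<inter> V) = measure (PiM I M) U * measure (PiM I M) V"
proof -
  interpret P: prob_space "PiM I M" using M by (rule prob_space_PiM)
  obtain d where d: "d \<in> space (PiM I M)" using P.not_empty by blast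
  have cyl: "\<exists>W'\<in>sets (PiM C M). W = (\<lambda>\<omega>. \<lambda>i\<in>C. \<omega> i) -` W' \<inter> space (PiM I M)"
    if C: "C \<subseteq> I" and W: "W \<in> sets (PiM I M)"
      and dep: "\<And>\<omega> \<omega>'. \<omega> \<in> W \<Longrightarrow> \<omega>' \<in> space (PiM I M) \<Longrightarrow> (\<And>i. i \<in> C \<Longrightarrow> \<omega> i = \<omega>' i) \<Longrightarrow> \<omega>' \<in> W"
    for C W
  proof
    define e where "e \<eta> = (\<lambda>i\<in>I. if i \<in> C then \<eta> i else d i)" for \<eta>
    have e: "e \<in> measurable (PiM C M) (PiM I M)"
      unfolding e_def
    proof (rule measurable_restrict)
      fix i assume i: "i \<in> I"
      show "(\<lambda>\<eta>. if i \<in> C then \<eta> i else d i) \<in> measurable (PiM C M) (M i)"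
        using i d by (cases "i \<in> C") (auto simp: space_PiM PiE_iff)
    qed
    show "e -` W \<inter> space (PiM C M) \<in> sets (PiM C M)"
      using measurable_sets[OF e W] .
    show "W = (\<lambda>\<omega>. \<lambda>i\<in>C. \<omega> i) -` (e -` W \<inter> space (PiM C M)) \<inter> space (PiM I M)"
    proof (intro set_eqI iffI)
      fix \<omega> assume \<omega>: "\<omega> \<in> W"
      then have sp: "\<omega> \<in> space (PiM I M)" using sets.sets_into_space[OF W] by blast
      then have r: "(\<lambda>i\<in>C. \<omega> i) \<in> space (PiM C M)"
        using C by (auto simp: space_PiM PiE_iff)
      then have "e (\<lambda>i\<in>C. \<omega> i) \<in> space (PiM I M)"
        by (rule measurable_space[OF e])
      then have "e (\<lambda>i\<in>C. \<omega> i) \<in> W"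
        by (rule dep[OF \<omega>]) (use C in \<open>auto simp: e_def\<close>)
      with r sp show "\<omega> \<in> (\<lambda>\<omega>. \<lambda>i\<in>C. \<omega> i) -` (e -` W \<inter> space (PiM C M)) \<inter> space (PiM I M)"
        by simp
    next
      fix \<omega> assume "\<omega> \<in> (\<lambda>\<omega>. \<lambda>i\<in>C. \<omega> i) -` (e -` W \<inter> space (PiM C M)) \<inter> space (PiM I M)"
      then have \<omega>: "e (\<lambda>i\<in>C. \<omega> i) \<in> W" "\<omega> \<in> space (PiM I M)" by auto
      show "\<omega> \<in> W"
        by (rule dep[OF \<omega>]) (use C in \<open>auto simp: e_def\<close>)
    qed
  qed
  have "\<exists>U'\<in>sets (PiM A M). U = (\<lambda>\<omega>. \<lambda>i\<in>A. \<omega> i) -` U' \<inter> space (PiM I M)"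
    by (rule cyl[OF AB(2) U]) (rule depU)
  then obtain U' where U': "U' \<in> sets (PiM A M)" "U = (\<lambda>\<omega>. \<lambda>i\<in>A. \<omega> i) -` U' \<inter> space (PiM I M)"
    by blast
  have "\<exists>V'\<in>sets (PiM B M). V = (\<lambda>\<omega>. \<lambda>i\<in>B. \<omega> i) -` V' \<inter> space (PiM I M)"
    by (rule cyl[OF AB(3) V]) (rule depV)
  then obtain V' where V': "V' \<in> sets (PiM B M)" "V = (\<lambda>\<omega>. \<lambda>i\<in>B. \<omega> i) -` V' \<inter> space (PiM I M)"
    by blast
  have "P.indep_var (PiM A M) (\<lambda>\<omega>. \<lambda>i\<in>A. \<omega> i) (PiM B M) (\<lambda>\<omega>. \<lambda>i\<in>B. \<omega> i)"
    by (rule P.indep_var_restrict[OF indep_vars_PiM_coordinates[OF I M] AB])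
  from P.indep_varD[OF this U'(1) V'(1)]
  show ?thesis
    by (simp add: U'(2) V'(2) vimage_def Int_def conj_ac cong: conj_cong)
qed

text \<open>The multipliers are unbounded, so each is cut at \<open>L\<close>. Half of the tolerance
  pays for the bias \<open>K / L ^ k\<close> of the cut, the other half for Hoeffding's inequality
  on values between 0 and \<open>L * B\<close>. The first term of the bound is Markov's inequality
  for the event that some multiplier exceeds \<open>L\<close> at all.\<close>

lemma weighted_noise_concentration:
  fixes w :: "'i \<Rightarrow> real" and D :: "real measure" and k :: nat
  defines "\<mu> \<equiv> (LINT x|D. max 0 x)" and "K \<equiv> (LINT x|D. (max 0 x) ^ Suc k)"
  assumes D: "prob_space D" "sets D = sets borel"
    and J: "J \<subseteq> I" "finite J" "J \<noteq> {}"
    and w: "\<And>j. j \<in> J \<Longrightarrow> 0 \<le> w j" "\<And>j. j \<in> J \<Longrightarrow> w j \<le> B" and B: "0 < B"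
    and L: "0 < L" and \<delta>: "0 < \<delta>"
    and int1: "integrable D (\<lambda>x. max 0 x)" and intk: "integrable D (\<lambda>x. (max 0 x) ^ Suc k)"
    and small: "K / L ^ k \<le> \<delta> / 2"
  shows "measure (PiM I (\<lambda>_. D)) {\<omega> \<in> space (PiM I (\<lambda>_. D)).
      real (card J) * \<delta> * B < \<bar>(\<Sum>j\<in>J. max 0 (\<omega> j) * w j) - \<mu> * (\<Sum>j\<in>J. w j)\<bar>}
    \<le> real (card J) * (K / L ^ Suc k) + 2 * exp (- real (card J) * \<delta>\<^sup>2 / (2 * L\<^sup>2))"
proof -
  let ?P = "PiM I (\<lambda>_. D)"
  interpret D: prob_space D by fact
  interpret P: prob_space ?P by (intro prob_space_PiM D)
  note [measurable_cong] = D(2)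
  have D_space: "space D = UNIV" using sets_eq_imp_space_eq[OF D(2)] by simp
  have coord [measurable]: "(\<lambda>\<omega>. \<omega> j) \<in> borel_measurable ?P" if "j \<in> J" for j
    using measurable_component_singleton[of j I "\<lambda>_. D"] J that
    by (auto simp: measurable_cong_sets[OF refl D(2)])
  define c where "c = real (card J)"
  have c: "0 < c" using J by (simp add: c_def card_gt_0_iff)
  define tr where "tr x = min L (max 0 x)" for x :: real
  have tr_meas [measurable]: "tr \<in> borel_measurable borel" unfolding tr_def by measurable
  have tr_D [measurable]: "tr \<in> borel_measurable D" using tr_meas by (simp add: measurable_cong_sets[OF D(2) refl])
  have tr01: "0 \<le> tr x" "tr x \<le> L" for x using L by (auto simp: tr_def)
  have int_tr: "integrable D tr"
    by (rule D.integrable_const_bound[where B = L]) (use tr01 tr_D in auto)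
  define \<mu>L where "\<mu>L = (LINT x|D. tr x)"
  \<comment> \<open>The difference vanishes up to \<open>L\<close>, and beyond \<open>L\<close> the
    factor \<open>(x / L) ^ k\<close> is at least 1.\<close>
  have pt: "max 0 x - tr x \<le> (max 0 x) ^ Suc k / L ^ k" for x
  proof (cases "x \<le> L")
    case True
    then show ?thesis using L by (auto simp: tr_def)
  next
    case False
    then have "max 0 x - tr x \<le> x" using L by (auto simp: tr_def)
    also have "x * L ^ k \<le> x * x ^ k"
      using False L by (intro mult_left_mono power_mono) auto
    then have "x \<le> x ^ Suc k / L ^ k" using L by (simp add: field_simps)
    finally show ?thesis using False L by (simp add: max_def)
  qed
  have bias: "0 \<le> \<mu> - \<mu>L" "\<mu> - \<mu>L \<le> \<delta> / 2"
  proof -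
    have eq: "\<mu> - \<mu>L = (LINT x|D. max 0 x - tr x)"
      unfolding \<mu>_def \<mu>L_def by (rule Bochner_Integration.integral_diff[symmetric]; fact)
    show "0 \<le> \<mu> - \<mu>L" unfolding eq by (intro integral_nonneg_AE) (auto simp: tr_def)
    have "\<mu> - \<mu>L \<le> (LINT x|D. (max 0 x) ^ Suc k / L ^ k)"
      unfolding eq using int1 int_tr intk pt by (intro integral_mono) auto
    also have "\<dots> = K / L ^ k" unfolding K_def by simp
    finally show "\<mu> - \<mu>L \<le> \<delta> / 2" using small by linarith
  qed
  define W where "W = (\<Sum>j\<in>J. w j)"
  have W: "0 \<le> W" "W \<le> c * B"
    using w sum_bounded_above[of J w B] by (auto simp: W_def c_def sum_nonneg)
  define X where "X j \<omega> = tr (\<omega> j) * w j" for j and \<omega> :: "'i \<Rightarrow> real"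
  have EX: "P.expectation (X j) = \<mu>L * w j" if j: "j \<in> J" for j
  proof -
    have "P.expectation (\<lambda>\<omega>. tr (\<omega> j)) = (LINT x|distr ?P D (\<lambda>\<omega>. \<omega> j). tr x)"
      using j J by (intro integral_distr[symmetric] tr_D) auto
    also have "distr ?P D (\<lambda>\<omega>. \<omega> j) = D"
      using j J by (intro distr_PiM_component D) auto
    finally show ?thesis by (simp add: X_def[abs_def] \<mu>L_def)
  qed
  interpret H: Hoeffding_ineq ?P J X "\<lambda>_. 0" "\<lambda>_. L * B" "\<mu>L * W"
  proof unfold_locales
    have "P.indep_vars (\<lambda>_. D) (\<lambda>i \<omega>. \<omega> i) J"
      by (rule P.indep_vars_subset[OF indep_vars_PiM_coordinates J(1)]) (use J D in auto)
    then show "P.indep_vars (\<lambda>_. borel) X J"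
      unfolding X_def by (rule P.indep_vars_compose2[where Y = "\<lambda>j x. tr x * w j"]) measurable
    show "AE \<omega> in ?P. X j \<omega> \<in> {0..L * B}" if "j \<in> J" for j
      using w that tr01 L by (auto simp: X_def intro!: AE_I2 mult_mono)
    show "\<mu>L * W \<equiv> \<Sum>j\<in>J. P.expectation (X j)"
      by (simp add: EX W_def sum_distrib_left)
  qed (use J in auto)
  let ?bad = "{\<omega> \<in> space ?P. c * \<delta> * B < \<bar>(\<Sum>j\<in>J. max 0 (\<omega> j) * w j) - \<mu> * W\<bar>}"
  let ?dev = "{\<omega> \<in> space ?P. c * \<delta> * B / 2 \<le> \<bar>(\<Sum>j\<in>J. X j \<omega>) - \<mu>L * W\<bar>}"
  let ?big = "\<lambda>j. {\<omega> \<in> space ?P. L < \<omega> j}"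
  have big_sets: "?big j \<in> P.events" if "j \<in> J" for j
    using coord[OF that] by measurable
  have dev_sets: "?dev \<in> P.events"
  proof -
    have [measurable]: "X j \<in> borel_measurable ?P" if "j \<in> J" for j
      using that by (rule H.random_variable)
    show ?thesis by measurable
  qed
  have sub: "?bad \<subseteq> (\<Union>j\<in>J. ?big j) \<union> ?dev"
  proof
    fix \<omega> assume bad: "\<omega> \<in> ?bad"
    show "\<omega> \<in> (\<Union>j\<in>J. ?big j) \<union> ?dev"
    proof (cases "\<exists>j\<in>J. L < \<omega> j")
      case True
      then show ?thesis using bad by auto
    next
      case False
      then have "(\<Sum>j\<in>J. max 0 (\<omega> j) * w j) = (\<Sum>j\<in>J. X j \<omega>)"
        using L by (intro sum.cong) (auto simp: X_def tr_def min_def max_def not_less)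
      moreover have "\<bar>(\<mu> - \<mu>L) * W\<bar> \<le> \<delta> / 2 * (c * B)"
        using bias W \<delta> mult_mono[of "\<mu> - \<mu>L" "\<delta> / 2" W "c * B"] by (simp add: abs_mult)
      then have "\<bar>\<mu> * W - \<mu>L * W\<bar> \<le> c * \<delta> * B / 2"
        by (simp add: algebra_simps)
      ultimately show ?thesis using bad by (simp add: abs_if split: if_splits)
    qed
  qed
  have "P.prob ?bad \<le> P.prob ((\<Union>j\<in>J. ?big j) \<union> ?dev)"
    by (intro P.finite_measure_mono[OF sub] sets.Un sets.finite_UN dev_sets big_sets J(2))
  also have "\<dots> \<le> P.prob (\<Union>j\<in>J. ?big j) + P.prob ?dev"
    by (intro measure_Un_le sets.finite_UN dev_sets big_sets J(2))
  also have "P.prob (\<Union>j\<in>J. ?big j) \<le> (\<Sum>j\<in>J. P.prob (?big j))"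
    using big_sets by (intro P.finite_measure_subadditive_finite J(2) image_subsetI)
  also have "\<dots> \<le> (\<Sum>j\<in>J. K / L ^ Suc k)"
  proof (intro sum_mono)
    fix j assume j: "j \<in> J"
    have "P.prob (?big j) = measure (distr ?P D (\<lambda>\<omega>. \<omega> j)) {L<..}"
      using j J by (subst measure_distr) (auto simp: D vimage_def intro!: arg_cong[where f = "P.prob"])
    also have "distr ?P D (\<lambda>\<omega>. \<omega> j) = D"
      using j J by (intro distr_PiM_component D) auto
    also have "measure D {L<..} \<le> measure D {x \<in> space D. L ^ Suc k \<le> (max 0 x) ^ Suc k}"
      using L by (intro D.finite_measure_mono) (auto simp: D_space intro!: mult_mono power_mono)
    also have "\<dots> \<le> K / L ^ Suc k"
      unfolding K_def using L intk by (intro integral_Markov_inequality_measure[where A = "{}"]) auto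
    finally show "P.prob (?big j) \<le> K / L ^ Suc k" .
  qed
  also have "P.prob ?dev \<le> 2 * exp (- 2 * (c * \<delta> * B / 2)\<^sup>2 / (\<Sum>j\<in>J. (L * B - 0)\<^sup>2))"
    by (rule H.Hoeffding_ineq_abs_ge) (use c \<delta> B L J in \<open>auto simp: card_gt_0_iff\<close>)
  also have "- 2 * (c * \<delta> * B / 2)\<^sup>2 / (\<Sum>j\<in>J. (L * B - 0)\<^sup>2) = - c * \<delta>\<^sup>2 / (2 * L\<^sup>2)"
    using c B L by (simp add: c_def[symmetric] field_simps power2_eq_square)
  finally show ?thesis by (simp add: c_def W_def)
qed

section \<open>Smoothing and approximate greedy maximization\<close>

definition smooth :: "'a set \<Rightarrow> ('a set \<Rightarrow> real) \<Rightarrow> 'a set \<Rightarrow> real" where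
  "smooth H f T = (\<Sum>X\<in>Pow H. f (T \<union> X)) / 2 ^ card H"

text \<open>Negative answers are cut off because only the upper tail of the noise is controlled.\<close>

definition estimate :: "'a set \<Rightarrow> ('a set \<Rightarrow> real) \<Rightarrow> 'a set \<Rightarrow> real" where
  "estimate H v = smooth H (\<lambda>X. max 0 (v X))"

text \<open>The choice is a function of the set of maximizers alone. It is therefore unaffected by
  values of \<open>u\<close> outside \<open>A\<close>, and for finite \<open>A\<close> it depends
  measurably on random values, since it factors through finitely many subsets.\<close>

definition argmax_on :: "'a set \<Rightarrow> ('a \<Rightarrow> real) \<Rightarrow> 'a" where
  "argmax_on A u = (SOME a. a \<in> {a \<in> A. \<forall>b\<in>A. u b \<le> u a})"

text \<open>Candidates from \<open>H\<close> are excluded so that \<open>X - H\<close> recovers the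
  extended set from a query \<open>X\<close>; hence steps from sets of different sizes never share a
  query.\<close>

definition greedy_step :: "'a set \<Rightarrow> 'a set \<Rightarrow> ('a set \<Rightarrow> real) \<Rightarrow> 'a set \<Rightarrow> 'a set" where
  "greedy_step N H v S =
     (if N - H - S = {} then S
      else insert (argmax_on (N - H - S) (\<lambda>a. estimate H v (insert a S))) S)"

definition greedy :: "'a set \<Rightarrow> 'a set \<Rightarrow> ('a set \<Rightarrow> real) \<Rightarrow> nat \<Rightarrow> 'a set" where
  "greedy N H v t = (greedy_step N H v ^^ t) {}"

lemma argmax_on:
  assumes "finite A" "A \<noteq> {}"
  shows "argmax_on A u \<in> A" and "b \<in> A \<Longrightarrow> u b \<le> u (argmax_on A u)"
proof -
  have "Max (u ` A) \<in> u ` A" using assms by (intro Max_in) auto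
  then obtain a where "a \<in> A" "u a = Max (u ` A)" by force
  then have "a \<in> {a \<in> A. \<forall>b\<in>A. u b \<le> u a}" using assms by auto
  then have "argmax_on A u \<in> {a \<in> A. \<forall>b\<in>A. u b \<le> u a}"
    unfolding argmax_on_def by (rule someI)
  then show "argmax_on A u \<in> A" and "b \<in> A \<Longrightarrow> u b \<le> u (argmax_on A u)" by auto
qed

lemma argmax_on_cong:
  assumes "\<And>a. a \<in> A \<Longrightarrow> u a = u' a"
  shows "argmax_on A u = argmax_on A u'"
proof -
  have "{a \<in> A. \<forall>b\<in>A. u b \<le> u a} = {a \<in> A. \<forall>b\<in>A. u' b \<le> u' a}"
    using assms by auto
  then show ?thesis by (simp add: argmax_on_def)
qed

lemma estimate_cong:
  assumes "\<And>X. X \<subseteq> H \<Longrightarrow> v (T \<union> X) = v' (T \<union> X)"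
  shows "estimate H v T = estimate H v' T"
  using assms by (auto simp: estimate_def smooth_def intro!: arg_cong2[where f = "(/)"] sum.cong)

definition step_queries :: "'a set \<Rightarrow> 'a set \<Rightarrow> 'a set \<Rightarrow> 'a set set" where
  "step_queries N H S = (\<lambda>(a, X). insert a S \<union> X) ` ((N - H - S) \<times> Pow H)"

text \<open>This locality lets the answers obtained in one step replace the whole oracle, both when
  greedy is simulated by queries and when its dependence on the noise is traced.\<close>

lemma greedy_step_cong:
  assumes "\<And>X. X \<in> step_queries N H S \<Longrightarrow> v X = v' X"
  shows "greedy_step N H v S = greedy_step N H v' S"
proof -
  have "argmax_on (N - H - S) (\<lambda>a. estimate H v (insert a S)) =
      argmax_on (N - H - S) (\<lambda>a. estimate H v' (insert a S))"
    by (intro argmax_on_cong estimate_cong assms) (force simp: step_queries_def)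
  then show ?thesis by (simp add: greedy_step_def)
qed

lemma greedy_step_subset:
  assumes "finite N" "S \<subseteq> N - H"
  shows "greedy_step N H v S \<subseteq> N - H"
  using assms argmax_on(1)[of "N - H - S" "\<lambda>a. estimate H v (insert a S)"]
  by (auto simp: greedy_step_def)

lemma greedy_0 [simp]: "greedy N H v 0 = {}"
  and greedy_Suc: "greedy N H v (Suc t) = greedy_step N H v (greedy N H v t)"
  by (simp_all add: greedy_def)

lemma greedy_subset: "finite N \<Longrightarrow> greedy N H v t \<subseteq> N - H"
  by (induction t) (simp_all only: greedy_0 greedy_Suc empty_subsetI greedy_step_subset)

lemma greedy_SucE:
  assumes N: "finite N" and t: "t < card (N - H)" and c: "card (greedy N H v t) = t"
  obtains a where "a \<in> N - H - greedy N H v t" "greedy N H v (Suc t) = insert a (greedy N H v t)"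
    "\<And>b. b \<in> N - H - greedy N H v t \<Longrightarrow>
       estimate H v (insert b (greedy N H v t)) \<le> estimate H v (insert a (greedy N H v t))"
proof -
  let ?S = "greedy N H v t"
  have "N - H - ?S \<noteq> {}"
    using t c card_mono[of ?S "N - H"] greedy_subset[OF N, of H v t] finite_subset[of ?S N] N
    by (auto simp: Diff_eq_empty_iff)
  with N that[of "argmax_on (N - H - ?S) (\<lambda>a. estimate H v (insert a ?S))"]
    argmax_on(1)[of "N - H - ?S" "\<lambda>a. estimate H v (insert a ?S)"]
    argmax_on(2)[of "N - H - ?S" _ "\<lambda>a. estimate H v (insert a ?S)"]
  show ?thesis by (simp add: greedy_Suc greedy_step_def)
qed

lemma card_greedy:
  assumes N: "finite N"
  shows "t \<le> card (N - H) \<Longrightarrow> card (greedy N H v t) = t"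
proof (induction t)
  case (Suc t)
  then have t: "t < card (N - H)" "card (greedy N H v t) = t" by auto
  then obtain a where "a \<in> N - H - greedy N H v t"
    "greedy N H v (Suc t) = insert a (greedy N H v t)"
    using greedy_SucE[OF N] by metis
  moreover have "finite (greedy N H v t)"
    using greedy_subset[OF N, of H v t] finite_subset N by (metis finite_Diff)
  ultimately show ?case using t by simp
qed simp

section \<open>Submodular greedy with inexact comparisons\<close>

text \<open>The elements of \<open>T\<close> are added one at a time; by submodularity each gains at
  most what it would gain when added to \<open>S\<close> directly.\<close>

lemma submodular_union_bound:
  fixes F :: "'a set \<Rightarrow> real"
  assumes G: "finite G"
    and sub: "\<And>S T. S \<subseteq> G \<Longrightarrow> T \<subseteq> G \<Longrightarrow> F (S \<union> T) + F (S \<inter> T) \<le> F S + F T"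
    and S: "S \<subseteq> G" and T: "T \<subseteq> G" "S \<inter> T = {}"
  shows "F (S \<union> T) \<le> F S + (\<Sum>a\<in>T. F (insert a S) - F S)"
proof -
  have "finite T" using T G finite_subset by blast
  then show ?thesis using T
  proof (induction T)
    case (insert a T)
    have "(S \<union> T) \<union> insert a S = S \<union> insert a T" "(S \<union> T) \<inter> insert a S = S"
      using insert by auto
    then have "F (S \<union> insert a T) + F S \<le> F (S \<union> T) + F (insert a S)"
      using sub[of "S \<union> T" "insert a S"] insert S by auto
    then show ?case using insert by simp
  qed simp
qed

text \<open>The classical contraction argument: the at most \<open>r\<close> elements of
  \<open>Q\<close> together close the gap to \<open>F Q\<close>, so the chosen candidate closes a
  fraction \<open>1 / r\<close> of it up to \<open>\<eta>\<close>. Later contractions only shrink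
  earlier errors, which thus add up to at most \<open>t * \<eta>\<close>. The step count is kept
  apart from \<open>r\<close> because greedy gets fewer steps than the optimum may have
  elements.\<close>

lemma approximate_greedy_bound:
  fixes F :: "'a set \<Rightarrow> real"
  assumes G: "finite G"
    and mono: "\<And>S T. S \<subseteq> T \<Longrightarrow> T \<subseteq> G \<Longrightarrow> F S \<le> F T"
    and sub: "\<And>S T. S \<subseteq> G \<Longrightarrow> T \<subseteq> G \<Longrightarrow> F (S \<union> T) + F (S \<inter> T) \<le> F S + F T"
    and S: "\<And>t. t \<le> k \<Longrightarrow> S t \<subseteq> G" "\<And>t. t < k \<Longrightarrow> S t \<subseteq> S (Suc t)"
    and gain: "\<And>t a. t < k \<Longrightarrow> a \<in> G - S t \<Longrightarrow> F (insert a (S t)) \<le> F (S (Suc t)) + \<eta>"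
    and opt: "Q \<subseteq> G" "card Q \<le> r" and r: "0 < r" and \<eta>: "0 \<le> \<eta>"
  shows "t \<le> k \<Longrightarrow> F Q - F (S t) \<le> (1 - 1 / r) ^ t * (F Q - F (S 0)) + t * \<eta>"
proof (induction t)
  case (Suc t)
  then have t: "t < k" by simp
  let ?d = "F (S (Suc t)) + \<eta> - F (S t)"
  \<comment> \<open>Nonnegativity of \<open>?d\<close> allows \<open>card (Q - S t)\<close> to be
    replaced by \<open>r\<close> below.\<close>
  have d: "0 \<le> ?d" using mono[OF S(2)[OF t] S(1)] t \<eta> by simp
  have "F Q \<le> F (S t \<union> (Q - S t))"
    using S(1)[of t] t opt by (intro mono) auto
  also have "\<dots> \<le> F (S t) + (\<Sum>a\<in>Q - S t. F (insert a (S t)) - F (S t))"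
    using S(1)[of t] t opt by (intro submodular_union_bound[OF G sub]) auto
  also have "\<dots> \<le> F (S t) + (\<Sum>a\<in>Q - S t. ?d)"
    using gain[OF t] opt by (intro add_left_mono sum_mono) (simp add: subset_iff)
  also have "\<dots> = F (S t) + card (Q - S t) * ?d" by simp
  also have "\<dots> \<le> F (S t) + r * ?d"
  proof -
    have "card (Q - S t) \<le> r"
      using card_mono[of Q "Q - S t"] opt G finite_subset[of Q G] by auto
    then show ?thesis using d by (intro add_left_mono mult_right_mono) auto
  qed
  finally have "(F Q - F (S t)) / r \<le> ?d"
    using r by (simp add: field_simps)
  then have "F Q - F (S (Suc t)) \<le> (1 - 1 / r) * (F Q - F (S t)) + \<eta>"
    by (simp add: left_diff_distrib)
  also have "\<dots> \<le> (1 - 1 / r) * ((1 - 1 / r) ^ t * (F Q - F (S 0)) + t * \<eta>) + \<eta>"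
    using Suc r by (intro add_right_mono mult_left_mono) auto
  also have "\<dots> \<le> (1 - 1 / r) ^ Suc t * (F Q - F (S 0)) + Suc t * \<eta>"
  proof -
    have "(1 - 1 / r) * (t * \<eta>) \<le> t * \<eta>"
      using r \<eta> by (intro mult_left_le_one_le) auto
    then show ?thesis by (simp add: distrib_left distrib_right mult.assoc)
  qed
  finally show ?case .
qed simp

lemma monotone_submodularD_mono:
  "monotone_submodular N f \<Longrightarrow> S \<subseteq> T \<Longrightarrow> T \<subseteq> N \<Longrightarrow> f S \<le> f T"
  by (simp add: monotone_submodular_def)

lemma monotone_submodularD_nonneg: "monotone_submodular N f \<Longrightarrow> S \<subseteq> N \<Longrightarrow> 0 \<le> f S"
  by (simp add: monotone_submodular_def)

lemma monotone_submodularD_submodular: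
  "monotone_submodular N f \<Longrightarrow> S \<subseteq> N \<Longrightarrow> T \<subseteq> N \<Longrightarrow> f (S \<union> T) + f (S \<inter> T) \<le> f S + f T"
  by (simp add: monotone_submodular_def)

text \<open>By submodularity, removing a block costs least when it is removed from the full
  \<open>Q\<close>. Removing all blocks one after the other therefore shows that the individual
  losses sum to at most \<open>f Q\<close>, and not all of them can exceed
  \<open>f Q / m\<close>.\<close>

lemma exists_block_with_small_loss:
  fixes m :: nat
  assumes f: "monotone_submodular N f" and Q: "Q \<subseteq> N" and m: "0 < m"
    and disj: "disjoint_family_on H {..<m}"
  shows "\<exists>i<m. (1 - 1 / m) * f Q \<le> f (Q - H i)"
proof (rule ccontr)
  assume "\<not> ?thesis"
  then have neg: "f (Q - H i) < (1 - 1 / m) * f Q" if "i < m" for i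
    using that by (auto simp: not_le)
  have "j \<le> m \<Longrightarrow> (\<Sum>i<j. f Q - f (Q - H i)) \<le> f Q - f (Q - (\<Union>i<j. H i))" for j
  proof (induction j)
    case (Suc j)
    have "H j \<inter> H i = {}" if "i < j" for i
      using Suc.prems that disj by (intro disjoint_family_onD[OF disj]) auto
    \<comment> \<open>Disjointness of the blocks enters through the union being all of
      \<open>Q\<close>.\<close>
    then have eq: "(Q - (\<Union>i<j. H i)) \<union> (Q - H j) = Q"
      "(Q - (\<Union>i<j. H i)) \<inter> (Q - H j) = Q - (\<Union>i<Suc j. H i)"
      by (auto simp: less_Suc_eq disjoint_iff)
    have "f ((Q - (\<Union>i<j. H i)) \<union> (Q - H j)) + f ((Q - (\<Union>i<j. H i)) \<inter> (Q - H j))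
        \<le> f (Q - (\<Union>i<j. H i)) + f (Q - H j)"
      using Q by (intro monotone_submodularD_submodular[OF f]) auto
    then show ?case using Suc unfolding eq by simp
  qed simp
  from this[of m] have "(\<Sum>i<m. f Q - f (Q - H i)) \<le> f Q - f (Q - (\<Union>i<m. H i))" by simp
  also have "\<dots> \<le> f Q"
    using monotone_submodularD_nonneg[OF f, of "Q - (\<Union>i<m. H i)"] Q by auto
  also have "f Q = (\<Sum>i<m. f Q / m)" using m by simp
  also have "\<dots> < (\<Sum>i<m. f Q - f (Q - H i))"
    using m neg by (intro sum_strict_mono) (auto simp: algebra_simps)
  finally show False by simp
qed

lemma smooth_mono_fun:
  "(\<And>X. X \<subseteq> H \<Longrightarrow> f (S \<union> X) \<le> g (T \<union> X)) \<Longrightarrow> smooth H f S \<le> smooth H g T"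
  by (auto simp: smooth_def intro!: divide_right_mono sum_mono)

context
  fixes N H :: "'a set" and f :: "'a set \<Rightarrow> real"
  assumes f: "monotone_submodular N f" and N: "finite N" and H: "H \<subseteq> N"
begin

lemma smooth_mono: "S \<subseteq> T \<Longrightarrow> T \<subseteq> N \<Longrightarrow> smooth H f S \<le> smooth H f T"
  using H by (intro smooth_mono_fun monotone_submodularD_mono[OF f]) auto

lemma smooth_submodular:
  assumes "S \<subseteq> N" "T \<subseteq> N"
  shows "smooth H f (S \<union> T) + smooth H f (S \<inter> T) \<le> smooth H f S + smooth H f T"
proof -
  have "f (S \<union> T \<union> X) + f (S \<inter> T \<union> X) \<le> f (S \<union> X) + f (T \<union> X)" if "X \<subseteq> H" for X
  proof -
    have "f ((S \<union> X) \<union> (T \<union> X)) + f ((S \<union> X) \<inter> (T \<union> X)) \<le> f (S \<union> X) + f (T \<union> X)"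
      using that H assms by (intro monotone_submodularD_submodular[OF f]) auto
    moreover have "(S \<union> X) \<union> (T \<union> X) = S \<union> T \<union> X" "(S \<union> X) \<inter> (T \<union> X) = S \<inter> T \<union> X" by auto
    ultimately show ?thesis by simp
  qed
  then show ?thesis
    unfolding smooth_def add_divide_distrib[symmetric] sum.distrib[symmetric]
    by (intro divide_right_mono sum_mono) auto
qed

lemma smooth_const: "smooth H (\<lambda>_. c) T = c"
  using finite_subset[OF H N] by (simp add: smooth_def card_Pow)

lemma smooth_ge: "T \<subseteq> N \<Longrightarrow> f T \<le> smooth H f T"
  using smooth_mono_fun[of H "\<lambda>_. f T" T f T] monotone_submodularD_mono[OF f, of T] H
  by (simp add: smooth_const subset_trans)

text \<open>The reason for returning a greedy set together with its block: a large smoothed value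
  becomes a large true value.\<close>

lemma smooth_le: "T \<subseteq> N \<Longrightarrow> smooth H f T \<le> f (T \<union> H)"
  using smooth_mono_fun[of H f T "\<lambda>_. f (T \<union> H)" T] monotone_submodularD_mono[OF f, of _ "T \<union> H"] H
  by (simp add: smooth_const sup.coboundedI2)

end

text \<open>Accuracy is demanded only for candidates that greedy compares along its own path.
  Demanding it for all sets up to size \<open>k\<close> would mean a union bound over far more sets
  than a polynomially small failure probability can pay for.\<close>

definition accurate_run ::
  "'a set \<Rightarrow> 'a set \<Rightarrow> ('a set \<Rightarrow> real) \<Rightarrow> ('a set \<Rightarrow> real) \<Rightarrow> real \<Rightarrow> real \<Rightarrow> nat \<Rightarrow> bool" where
  "accurate_run N H f v \<mu> \<eta> k \<longleftrightarrow>
     (\<forall>t<k. \<forall>a\<in>N - H - greedy N H v t.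
        \<bar>estimate H v (insert a (greedy N H v t)) - \<mu> * smooth H f (insert a (greedy N H v t))\<bar> \<le> \<eta>)"

text \<open>As \<open>\<mu> \<ge> 1\<close>, undoing the unknown factor cannot enlarge the error;
  comparing estimates thus compares true values up to \<open>2 * \<eta>\<close>.\<close>

lemma scaled_diff_le:
  fixes x y :: real
  assumes "\<mu> * x - \<eta> \<le> e" "e \<le> \<mu> * y + \<eta>" "1 \<le> \<mu>" "0 \<le> \<eta>"
  shows "x \<le> y + 2 * \<eta>"
proof (cases "x \<le> y")
  case False
  then have "x - y \<le> \<mu> * (x - y)" using assms(3) mult_right_mono[of 1 \<mu> "x - y"] by simp
  then show ?thesis using assms by (simp add: algebra_simps)
qed (use assms in simp)

text \<open>The final set is the winning candidate of the last step, so its estimate is already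
  covered and runs can be compared without fresh samples.\<close>

lemma accurate_run_final:
  assumes acc: "accurate_run N H f v \<mu> \<eta> k" and N: "finite N" and k: "0 < k" "k \<le> card (N - H)"
  shows "\<bar>estimate H v (greedy N H v k) - \<mu> * smooth H f (greedy N H v k)\<bar> \<le> \<eta>"
proof -
  obtain t where t: "k = Suc t" using k by (cases k) auto
  then obtain a where a: "a \<in> N - H - greedy N H v t"
    "greedy N H v (Suc t) = insert a (greedy N H v t)"
    using greedy_SucE[of N t H v] card_greedy[OF N, of t H v] k N by (metis Suc_le_eq Suc_leD)
  then show ?thesis using acc by (auto simp: accurate_run_def t)
qed

text \<open>Greedy never picks from \<open>H\<close>, so its competitor is \<open>Q - H\<close>.
  Each comparison involves two estimates, which doubles the error per step to
  \<open>2 * \<eta>\<close>.\<close>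

lemma accurate_run_value:
  assumes f: "monotone_submodular N f" and N: "finite N" and H: "H \<subseteq> N"
    and acc: "accurate_run N H f v \<mu> \<eta> k" and k: "k \<le> card (N - H)"
    and \<mu>: "1 \<le> \<mu>" and \<eta>: "0 \<le> \<eta>" and Q: "Q \<subseteq> N" "card Q \<le> r" and r: "0 < r"
  shows "(1 - exp (- real k / real r)) * smooth H f (Q - H) - 2 * k * \<eta> \<le> smooth H f (greedy N H v k)"
proof -
  let ?F = "smooth H f" and ?S = "greedy N H v"
  have S: "?S t \<subseteq> N - H" for t by (rule greedy_subset[OF N])
  have "?F (Q - H) - ?F (?S k) \<le> (1 - 1 / r) ^ k * (?F (Q - H) - ?F (?S 0)) + k * (2 * \<eta>)"
  proof (rule approximate_greedy_bound[where G = "N - H" and k = k and \<eta> = "2 * \<eta>" and S = ?S])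
    show "?F A \<le> ?F B" if "A \<subseteq> B" "B \<subseteq> N - H" for A B
      using that by (intro smooth_mono[OF f N H]) auto
    show "?F (A \<union> B) + ?F (A \<inter> B) \<le> ?F A + ?F B" if "A \<subseteq> N - H" "B \<subseteq> N - H" for A B
      using that by (intro smooth_submodular[OF f N H]) auto
    show "?S t \<subseteq> ?S (Suc t)" for t by (auto simp: greedy_Suc greedy_step_def)
    show "card (Q - H) \<le> r"
      using card_mono[of Q "Q - H"] Q N finite_subset[of Q N] by auto
    show "?F (insert b (?S t)) \<le> ?F (?S (Suc t)) + 2 * \<eta>" if t: "t < k" and b: "b \<in> N - H - ?S t" for t b
    proof -
      have t': "t < card (N - H)" using t k by simp
      obtain a where a: "a \<in> N - H - ?S t" "?S (Suc t) = insert a (?S t)"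
        "\<And>b. b \<in> N - H - ?S t \<Longrightarrow>
          estimate H v (insert b (?S t)) \<le> estimate H v (insert a (?S t))"
        by (rule greedy_SucE[OF N t' card_greedy[OF N less_imp_le[OF t']]]) blast
      have "\<bar>estimate H v (insert c (?S t)) - \<mu> * ?F (insert c (?S t))\<bar> \<le> \<eta>" if "c \<in> {a, b}" for c
        using acc t a b that by (auto simp: accurate_run_def)
      from this[of a] this[of b] show ?thesis
        using a(3)[OF b] \<mu> \<eta> unfolding a(2) by (intro scaled_diff_le[where \<mu> = \<mu> and e = "estimate H v (insert b (?S t))"]) auto
    qed
  qed (use N S Q r \<eta> in auto)
  moreover have "(1 - 1 / r) ^ k * (?F (Q - H) - ?F (?S 0)) \<le> exp (- real k / real r) * ?F (Q - H)"
  proof (rule mult_mono)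
    have "(1 - 1 / real r) ^ k \<le> exp (- 1 / real r) ^ k"
      using r exp_ge_add_one_self[of "- 1 / real r"] by (intro power_mono) auto
    also have "\<dots> = exp (- real k / real r)" by (simp add: exp_of_nat_mult[symmetric])
    finally show "(1 - 1 / real r) ^ k \<le> exp (- real k / real r)" .
    have "0 \<le> f {}" using f by (simp add: monotone_submodular_def)
    then show "?F (Q - H) - ?F (?S 0) \<le> ?F (Q - H)"
      using smooth_ge[OF f N H, of "{}"] by simp
    show "0 \<le> ?F (Q - H) - ?F (?S 0)"
      using smooth_mono[OF f N H, of "{}" "Q - H"] Q by auto
  qed auto
  ultimately show ?thesis by (simp add: algebra_simps)
qed

section \<open>The query algorithm\<close>

text \<open>\<open>SOME\<close> fixes one enumeration of \<open>N\<close>, the same for every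
  \<open>i\<close>, so consecutive index intervals give disjoint blocks. The choice sits inside the
  definition because the algorithm has to be a function of \<open>N\<close>.\<close>

definition block :: "'a set \<Rightarrow> nat \<Rightarrow> nat \<Rightarrow> 'a set" where
  "block N h i = (SOME e. bij_betw e {0..<card N} N) ` {i * h..<Suc i * h}"

lemma blocks:
  assumes N: "finite N" and fit: "m * h \<le> card N"
  shows block_subset: "i < m \<Longrightarrow> block N h i \<subseteq> N"
    and card_block: "i < m \<Longrightarrow> card (block N h i) = h"
    and disjoint_blocks: "disjoint_family_on (block N h) {..<m}"
proof -
  define e where "e = (SOME e. bij_betw e {0..<card N} N)"
  have e: "bij_betw e {0..<card N} N"
    unfolding e_def using ex_bij_betw_nat_finite[OF N] by (rule someI_ex)
  then have inj: "inj_on e {0..<card N}" by (simp add: bij_betw_def)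
  have sub: "{i * h..<Suc i * h} \<subseteq> {0..<card N}" if "i < m" for i
  proof -
    have "Suc i * h \<le> m * h" using that by (intro mult_le_mono1) simp
    then show ?thesis using fit by auto
  qed
  have b: "block N h i = e ` {i * h..<Suc i * h}" for i by (simp add: block_def e_def)
  show "block N h i \<subseteq> N" if "i < m"
    unfolding b using sub[OF that] e by (auto simp: bij_betw_def)
  show "card (block N h i) = h" if "i < m"
    unfolding b using inj_on_subset[OF inj sub[OF that]] by (simp add: card_image)
  show "disjoint_family_on (block N h) {..<m}"
    unfolding disjoint_family_on_def
  proof (intro ballI impI)
    fix i j assume ij: "i \<in> {..<m}" "j \<in> {..<m}" "i \<noteq> j"
    have "{i * h..<Suc i * h} \<inter> {j * h..<Suc j * h} = {}"
    proof (cases "i < j")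
      case True
      then have "Suc i * h \<le> j * h" by (intro mult_le_mono1) simp
      then show ?thesis by auto
    next
      case False
      then have "Suc j * h \<le> i * h" using ij by (intro mult_le_mono1) simp
      then show ?thesis by auto
    qed
    then show "block N h i \<inter> block N h j = {}"
      unfolding b using inj_on_image_Int[OF inj sub sub, of i j] ij by auto
  qed
qed

section \<open>Simulation of the greedy runs by queries\<close>

text \<open>The answers reach the continuation as a table with default 0 at sets not asked; the
  default is harmless when only asked sets are looked up.\<close>

primrec query_list :: "'a set list \<Rightarrow> (('a set \<Rightarrow> real) \<Rightarrow> 'a query_alg) \<Rightarrow> 'a query_alg" where
  "query_list [] k = k (\<lambda>_. 0)"
| "query_list (X # Xs) k = Query X (\<lambda>y. query_list Xs (\<lambda>w. k (w(X := y))))"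

lemma query_list_correct:
  "alg_output (query_list Xs k) v = alg_output (k (\<lambda>X. if X \<in> set Xs then v X else 0)) v"
  "alg_queries (query_list Xs k) v = Xs @ alg_queries (k (\<lambda>X. if X \<in> set Xs then v X else 0)) v"
proof -
  have upd: "(\<lambda>Y. if Y \<in> set Xs then v Y else 0)(X := v X) =
      (\<lambda>Y. if Y \<in> set (X # Xs) then v Y else 0)" for X :: "'a set" and Xs
    by auto
  show "alg_output (query_list Xs k) v = alg_output (k (\<lambda>X. if X \<in> set Xs then v X else 0)) v"
    by (induction Xs arbitrary: k) (simp_all only: query_list.simps alg_output.simps upd, simp)
  show "alg_queries (query_list Xs k) v = Xs @ alg_queries (k (\<lambda>X. if X \<in> set Xs then v X else 0)) v"
    by (induction Xs arbitrary: k) (simp_all only: query_list.simps alg_queries.simps upd, simp_all)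
qed

definition query_set :: "'a set set \<Rightarrow> (('a set \<Rightarrow> real) \<Rightarrow> 'a query_alg) \<Rightarrow> 'a query_alg" where
  "query_set \<X> = query_list (SOME Xs. set Xs = \<X> \<and> distinct Xs)"

lemma query_set_correct:
  assumes "finite \<X>"
  shows "alg_output (query_set \<X> k) v = alg_output (k (\<lambda>X. if X \<in> \<X> then v X else 0)) v"
    and "\<exists>Xs. set Xs = \<X> \<and> length Xs = card \<X> \<and>
      alg_queries (query_set \<X> k) v = Xs @ alg_queries (k (\<lambda>X. if X \<in> \<X> then v X else 0)) v"
proof -
  define Xs where "Xs = (SOME Xs. set Xs = \<X> \<and> distinct Xs)"
  have Xs: "set Xs = \<X>" "distinct Xs"
    using someI_ex[OF finite_distinct_list[OF assms]] by (auto simp: Xs_def)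
  show "alg_output (query_set \<X> k) v = alg_output (k (\<lambda>X. if X \<in> \<X> then v X else 0)) v"
    by (simp add: query_set_def Xs_def[symmetric] query_list_correct Xs)
  show "\<exists>Xs. set Xs = \<X> \<and> length Xs = card \<X> \<and>
      alg_queries (query_set \<X> k) v = Xs @ alg_queries (k (\<lambda>X. if X \<in> \<X> then v X else 0)) v"
    using Xs by (intro exI[of _ Xs])
      (auto simp: query_set_def Xs_def[symmetric] query_list_correct distinct_card[symmetric])
qed

text \<open>Continuation-passing takes the place of sequential composition: \<open>k\<close> says
  how to go on from the resulting greedy set. Each step sees only the table of its own
  queries.\<close>

primrec greedy_alg ::
  "'a set \<Rightarrow> 'a set \<Rightarrow> nat \<Rightarrow> 'a set \<Rightarrow> ('a set \<Rightarrow> 'a query_alg) \<Rightarrow> 'a query_alg" where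
  "greedy_alg N H 0 S k = k S"
| "greedy_alg N H (Suc t) S k =
     query_set (step_queries N H S) (\<lambda>v. greedy_alg N H t (greedy_step N H v S) k)"

lemma step_queries:
  assumes N: "finite N" and S: "S \<subseteq> N" and H: "H \<subseteq> N"
  shows finite_step_queries: "finite (step_queries N H S)"
    and step_queries_subset: "step_queries N H S \<subseteq> Pow N"
    and card_step_queries: "card (step_queries N H S) \<le> card N * 2 ^ card H"
proof -
  have fin: "finite (N - H - S)" "finite (Pow H)" using N finite_subset[OF H N] by auto
  then show "finite (step_queries N H S)" by (auto simp: step_queries_def)
  show "step_queries N H S \<subseteq> Pow N" using S H by (auto simp: step_queries_def)
  have "card (step_queries N H S) \<le> card ((N - H - S) \<times> Pow H)"
    unfolding step_queries_def using fin by (intro card_image_le) auto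
  also have "\<dots> = card (N - H - S) * 2 ^ card H"
    using fin by (simp add: card_cartesian_product card_Pow)
  also have "\<dots> \<le> card N * 2 ^ card H"
    using N by (intro mult_le_mono1 card_mono) auto
  finally show "card (step_queries N H S) \<le> card N * 2 ^ card H" .
qed

lemma greedy_alg_correct:
  assumes N: "finite N" and H: "H \<subseteq> N" and S: "S \<subseteq> N - H"
  shows "alg_output (greedy_alg N H t S k) v = alg_output (k ((greedy_step N H v ^^ t) S)) v"
    and "\<exists>Xs. set Xs \<subseteq> Pow N \<and> length Xs \<le> t * (card N * 2 ^ card H) \<and>
      alg_queries (greedy_alg N H t S k) v = Xs @ alg_queries (k ((greedy_step N H v ^^ t) S)) v"
proof -
  have step: "greedy_step N H (\<lambda>X. if X \<in> step_queries N H S then v X else 0) S = greedy_step N H v S" for S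
    by (rule greedy_step_cong) simp
  show "alg_output (greedy_alg N H t S k) v = alg_output (k ((greedy_step N H v ^^ t) S)) v"
    using S
  proof (induction t arbitrary: S)
    case (Suc t)
    have fin: "finite (step_queries N H S)" using finite_step_queries[OF N _ H] Suc.prems by auto
    show ?case
      using Suc.IH[OF greedy_step_subset[OF N Suc.prems]]
      by (simp add: query_set_correct(1)[OF fin] step funpow_swap1)
  qed simp
  show "\<exists>Xs. set Xs \<subseteq> Pow N \<and> length Xs \<le> t * (card N * 2 ^ card H) \<and>
      alg_queries (greedy_alg N H t S k) v = Xs @ alg_queries (k ((greedy_step N H v ^^ t) S)) v"
    using S
  proof (induction t arbitrary: S)
    case (Suc t)
    have S: "S \<subseteq> N" using Suc.prems by auto
    obtain Xs where Xs: "set Xs \<subseteq> Pow N" "length Xs \<le> t * (card N * 2 ^ card H)"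
      "alg_queries (greedy_alg N H t (greedy_step N H v S) k) v =
        Xs @ alg_queries (k ((greedy_step N H v ^^ t) (greedy_step N H v S))) v"
      using Suc.IH[OF greedy_step_subset[OF N Suc.prems]] by blast
    obtain Ys where Ys: "set Ys = step_queries N H S" "length Ys = card (step_queries N H S)"
      "alg_queries (greedy_alg N H (Suc t) S k) v =
        Ys @ alg_queries (greedy_alg N H t (greedy_step N H v S) k) v"
      using query_set_correct(2)[OF finite_step_queries[OF N S H],
          of "\<lambda>w. greedy_alg N H t (greedy_step N H w S) k" v]
      by (auto simp: step)
    show ?case
      using Xs Ys step_queries_subset[OF N S H] card_step_queries[OF N S H]
      by (intro exI[of _ "Ys @ Xs"]) (auto simp: funpow_swap1)
  qed simp
qed

primrec runs_alg ::
  "'a set \<Rightarrow> nat \<Rightarrow> 'a set list \<Rightarrow> (('a set \<times> 'a set) list \<Rightarrow> 'a query_alg) \<Rightarrow> 'a query_alg" where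
  "runs_alg N t [] k = k []"
| "runs_alg N t (H # Hs) k = greedy_alg N H t {} (\<lambda>S. runs_alg N t Hs (\<lambda>ps. k ((H, S) # ps)))"

lemma runs_alg_correct:
  assumes N: "finite N" and Hs: "\<And>H. H \<in> set Hs \<Longrightarrow> H \<subseteq> N" "\<And>H. H \<in> set Hs \<Longrightarrow> card H = h"
  shows "alg_output (runs_alg N t Hs k) v = alg_output (k (map (\<lambda>H. (H, greedy N H v t)) Hs)) v"
    and "\<exists>Xs. set Xs \<subseteq> Pow N \<and> length Xs \<le> length Hs * (t * (card N * 2 ^ h)) \<and>
      alg_queries (runs_alg N t Hs k) v = Xs @ alg_queries (k (map (\<lambda>H. (H, greedy N H v t)) Hs)) v"
proof -
  show "alg_output (runs_alg N t Hs k) v = alg_output (k (map (\<lambda>H. (H, greedy N H v t)) Hs)) v"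
    using Hs by (induction Hs arbitrary: k) (simp_all add: greedy_alg_correct(1)[OF N] greedy_def)
  show "\<exists>Xs. set Xs \<subseteq> Pow N \<and> length Xs \<le> length Hs * (t * (card N * 2 ^ h)) \<and>
      alg_queries (runs_alg N t Hs k) v = Xs @ alg_queries (k (map (\<lambda>H. (H, greedy N H v t)) Hs)) v"
    using Hs
  proof (induction Hs arbitrary: k)
    case (Cons H Hs)
    obtain Xs where Xs: "set Xs \<subseteq> Pow N" "length Xs \<le> length Hs * (t * (card N * 2 ^ h))"
      "alg_queries (runs_alg N t Hs (\<lambda>ps. k ((H, greedy N H v t) # ps))) v =
        Xs @ alg_queries (k ((H, greedy N H v t) # map (\<lambda>H. (H, greedy N H v t)) Hs)) v"
      using Cons.IH[of "\<lambda>ps. k ((H, greedy N H v t) # ps)"] Cons.prems by auto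
    obtain Ys where Ys: "set Ys \<subseteq> Pow N" "length Ys \<le> t * (card N * 2 ^ card H)"
      "alg_queries (runs_alg N t (H # Hs) k) v =
        Ys @ alg_queries (runs_alg N t Hs (\<lambda>ps. k ((H, greedy N H v t) # ps))) v"
      using greedy_alg_correct(2)[OF N, of H "{}" t "\<lambda>S. runs_alg N t Hs (\<lambda>ps. k ((H, S) # ps))" v] Cons.prems
      by (auto simp: greedy_def)
    show ?case
      using Xs Ys Cons.prems by (intro exI[of _ "Ys @ Xs"]) auto
  qed simp
qed

definition best_run :: "('a set \<Rightarrow> real) \<Rightarrow> ('a set \<times> 'a set) list \<Rightarrow> 'a set" where
  "best_run v ps = (case argmax_on (set ps) (\<lambda>(H, S). estimate H v S) of (H, S) \<Rightarrow> S \<union> H)"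

text \<open>Only the pairs of block and greedy set are handed on, so the values behind the final
  estimates are queried once more; a repeated query receives the same answer. This is the
  \<open>+ 1\<close> in the query count.\<close>

definition best_of_runs_alg :: "'a set \<Rightarrow> nat \<Rightarrow> 'a set list \<Rightarrow> 'a query_alg" where
  "best_of_runs_alg N t Hs = runs_alg N t Hs
     (\<lambda>ps. query_set (\<Union>(H, S)\<in>set ps. (\<union>) S ` Pow H) (\<lambda>v. Return (best_run v ps)))"

lemma best_of_runs_alg_correct:
  assumes N: "finite N" and Hs: "\<And>H. H \<in> set Hs \<Longrightarrow> H \<subseteq> N" "\<And>H. H \<in> set Hs \<Longrightarrow> card H = h"
  shows "alg_output (best_of_runs_alg N t Hs) v = best_run v (map (\<lambda>H. (H, greedy N H v t)) Hs)"
    and "set (alg_queries (best_of_runs_alg N t Hs) v) \<subseteq> Pow N"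
    and "length (alg_queries (best_of_runs_alg N t Hs) v) \<le> length Hs * ((t * card N + 1) * 2 ^ h)"
proof -
  define ps where "ps = map (\<lambda>H. (H, greedy N H v t)) Hs"
  define \<X> where "\<X> = (\<Union>(H, S)\<in>set ps. (\<union>) S ` Pow H)"
  have \<X>_eq: "\<X> = (\<Union>H\<in>set Hs. (\<union>) (greedy N H v t) ` Pow H)"
    by (auto simp: \<X>_def ps_def)
  have fin: "finite H" if "H \<in> set Hs" for H using finite_subset[OF Hs(1)[OF that] N] .
  have fin\<X>: "finite \<X>" using fin by (auto simp: \<X>_eq)
  have best: "best_run (\<lambda>X. if X \<in> \<X> then v X else 0) ps = best_run v ps"
    unfolding best_run_def
    by (intro arg_cong[where f = "case_prod (\<lambda>H S. S \<union> H)"] argmax_on_cong)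
       (force intro!: estimate_cong simp: \<X>_def)
  show "alg_output (best_of_runs_alg N t Hs) v = best_run v (map (\<lambda>H. (H, greedy N H v t)) Hs)"
    unfolding best_of_runs_alg_def
    by (subst runs_alg_correct(1)[OF N])
       (simp_all add: Hs ps_def[symmetric] \<X>_def[symmetric] query_set_correct(1)[OF fin\<X>] best)
  obtain Xs where Xs: "set Xs \<subseteq> Pow N" "length Xs \<le> length Hs * (t * (card N * 2 ^ h))"
    "alg_queries (best_of_runs_alg N t Hs) v =
      Xs @ alg_queries (query_set \<X> (\<lambda>v. Return (best_run v ps))) v"
    using runs_alg_correct(2)[OF N Hs] unfolding best_of_runs_alg_def ps_def \<X>_def by blast
  obtain Ys where Ys: "set Ys = \<X>" "length Ys = card \<X>"
    "alg_queries (query_set \<X> (\<lambda>v. Return (best_run v ps))) v = Ys"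
    using query_set_correct(2)[OF fin\<X>, of "\<lambda>v. Return (best_run v ps)" v] by auto
  have "\<X> \<subseteq> Pow N" using Hs(1) greedy_subset[OF N] by (fastforce simp: \<X>_eq)
  with Xs Ys show "set (alg_queries (best_of_runs_alg N t Hs) v) \<subseteq> Pow N" by auto
  have "card \<X> \<le> (\<Sum>H\<in>set Hs. card ((\<union>) (greedy N H v t) ` Pow H))"
    unfolding \<X>_eq by (rule card_UN_le) simp
  also have "\<dots> \<le> (\<Sum>H\<in>set Hs. 2 ^ h)"
    using fin Hs(2) by (intro sum_mono) (metis card_Pow card_image_le finite_Pow_iff)
  also have "\<dots> \<le> length Hs * 2 ^ h" by (simp add: card_length)
  finally show "length (alg_queries (best_of_runs_alg N t Hs) v) \<le> length Hs * ((t * card N + 1) * 2 ^ h)"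
    using Xs Ys by (simp add: algebra_simps)
qed

section \<open>Reliability of adaptively chosen estimates\<close>

lemma best_run_cases:
  assumes "ps \<noteq> []"
  obtains H S where "(H, S) \<in> set ps" "best_run v ps = S \<union> H"
    "\<And>H' S'. (H', S') \<in> set ps \<Longrightarrow> estimate H' v S' \<le> estimate H v S"
proof -
  obtain H S where HS: "argmax_on (set ps) (\<lambda>(H, S). estimate H v S) = (H, S)" by force
  then have "(H, S) \<in> set ps" "best_run v ps = S \<union> H"
    using argmax_on(1)[of "set ps" "\<lambda>(H, S). estimate H v S"] assms by (auto simp: best_run_def)
  moreover have "estimate H' v S' \<le> estimate H v S" if "(H', S') \<in> set ps" for H' S'
    using argmax_on(2)[of "set ps" "(H', S')" "\<lambda>(H, S). estimate H v S"] that assms HS by auto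
  ultimately show ?thesis using that by blast
qed

lemma best_run_feasible:
  assumes N: "finite N" and Hs: "Hs \<noteq> []" "\<And>H. H \<in> set Hs \<Longrightarrow> H \<subseteq> N" "\<And>H. H \<in> set Hs \<Longrightarrow> card H = h"
    and hr: "h \<le> r" "r \<le> card N"
  shows "best_run v (map (\<lambda>H. (H, greedy N H v (r - h))) Hs) \<in> card_constraint N r"
proof -
  have "map (\<lambda>H. (H, greedy N H v (r - h))) Hs \<noteq> []" using Hs(1) by simp
  then obtain H S where HS: "(H, S) \<in> set (map (\<lambda>H. (H, greedy N H v (r - h))) Hs)"
    "best_run v (map (\<lambda>H. (H, greedy N H v (r - h))) Hs) = S \<union> H"
    by (rule best_run_cases[where v = v]) blast
  then have H: "H \<in> set Hs" and S: "S = greedy N H v (r - h)" by auto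
  have "card (N - H) = card N - h"
    using Hs(2,3)[OF H] N finite_subset card_Diff_subset by metis
  then have "card S = r - h"
    unfolding S using hr by (intro card_greedy[OF N]) simp
  then have "card (S \<union> H) \<le> r"
    using card_Un_le[of S H] Hs(3)[OF H] hr by simp
  moreover have "S \<union> H \<subseteq> N" using greedy_subset[OF N] Hs(2)[OF H] by (auto simp: S)
  ultimately show ?thesis unfolding HS(2) by (simp add: card_constraint_def)
qed

text \<open>The algorithm does not know which block \<open>i\<close> has a small loss, but the
  selected run \<open>j\<close> is worse by at most one comparison error. The error
  \<open>2 * (r - h) * \<eta>\<close> of run \<open>i\<close> and \<open>2 * \<eta>\<close> for this
  comparison give the factor \<open>r - h + 1\<close>.\<close>

lemma accurate_runs_approximation:
  fixes N :: "'a set" and v :: "'a set \<Rightarrow> real" and m h r :: nat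
  defines "out \<equiv> best_run v (map (\<lambda>H. (H, greedy N H v (r - h))) (map (block N h) [0..<m]))"
  assumes f: "monotone_submodular N f" and N: "finite N" and m: "0 < m" "m * h \<le> card N"
    and hr: "h < r" "r \<le> card N"
    and acc: "\<And>i. i < m \<Longrightarrow> accurate_run N (block N h i) f v \<mu> \<eta> (r - h)"
    and \<mu>: "1 \<le> \<mu>" and \<eta>: "0 \<le> \<eta>" and Q: "Q \<subseteq> N" "card Q \<le> r"
  shows "(1 - exp (- real (r - h) / real r)) * ((1 - 1 / m) * f Q) - 2 * real (r - h + 1) * \<eta> \<le> f (out)"
proof -
  let ?F = "\<lambda>i. smooth (block N h i) f" and ?S = "\<lambda>i. greedy N (block N h i) v (r - h)"
  note blk = block_subset[OF N m(2)] card_block[OF N m(2)]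
  have k: "0 < r - h" "r - h \<le> card (N - block N h i)" if "i < m" for i
  proof -
    have "card (N - block N h i) = card N - h"
      using blk[OF that] N finite_subset card_Diff_subset by metis
    then show "0 < r - h" "r - h \<le> card (N - block N h i)" using hr by auto
  qed
  obtain i where i: "i < m" "(1 - 1 / m) * f Q \<le> f (Q - block N h i)"
    using exists_block_with_small_loss[OF f Q(1) m(1) disjoint_blocks[OF N m(2)]] by blast
  have "map (\<lambda>H. (H, greedy N H v (r - h))) (map (block N h) [0..<m]) \<noteq> []" using m by simp
  then obtain H S where HS: "(H, S) \<in> set (map (\<lambda>H. (H, greedy N H v (r - h))) (map (block N h) [0..<m]))"
    "out = S \<union> H"
    "\<And>H' S'. (H', S') \<in> set (map (\<lambda>H. (H, greedy N H v (r - h))) (map (block N h) [0..<m])) \<Longrightarrow>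
       estimate H' v S' \<le> estimate H v S"
    unfolding out_def by (rule best_run_cases[where v = v]) blast
  then obtain j where j: "j < m" "H = block N h j" "S = ?S j" by auto
  have est: "estimate (block N h i) v (?S i) \<le> estimate (block N h j) v (?S j)"
    using HS(3)[of "block N h i" "?S i"] i j by auto
  have "(1 - exp (- real (r - h) / real r)) * ((1 - 1 / m) * f Q) \<le>
      (1 - exp (- real (r - h) / real r)) * ?F i (Q - block N h i)"
  proof (rule mult_left_mono)
    show "(1 - 1 / m) * f Q \<le> ?F i (Q - block N h i)"
      using Q by (intro order.trans[OF i(2) smooth_ge[OF f N blk(1)[OF i(1)]]]) auto
  qed (simp)
  also have "\<dots> \<le> ?F i (?S i) + 2 * real (r - h) * \<eta>"
    using accurate_run_value[OF f N blk(1)[OF i(1)] acc[OF i(1)] k(2)[OF i(1)] \<mu> \<eta> Q] hr by simp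
  also have "?F i (?S i) \<le> ?F j (?S j) + 2 * \<eta>"
    using accurate_run_final[OF acc N k, of i i] accurate_run_final[OF acc N k, of j j] i j est \<mu> \<eta>
    by (intro scaled_diff_le[where e = "estimate (block N h i) v (?S i)"]) (auto simp: abs_le_iff)
  also have "?F j (?S j) \<le> f (out)"
    using smooth_le[OF f N blk(1)[OF j(1)], of "?S j"] greedy_subset[OF N] j HS(2) by force
  finally show ?thesis by (simp add: algebra_simps)
qed

section \<open>Measurability of the adaptive choices\<close>

lemma measurable_count_space_subset:
  "g \<in> measurable M (count_space UNIV) \<Longrightarrow> (\<And>x. x \<in> space M \<Longrightarrow> g x \<in> X) \<Longrightarrow> g \<in> measurable M (count_space X)"
  by (auto simp: measurable_def)

lemma measurable_argmax_on:
  assumes A: "finite A" and u: "\<And>a. a \<in> A \<Longrightarrow> (\<lambda>x. u x a) \<in> borel_measurable M"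
  shows "(\<lambda>x. argmax_on A (u x)) \<in> measurable M (count_space UNIV)"
proof -
  have "(\<lambda>x. {a \<in> A. \<forall>b\<in>A. u x b \<le> u x a}) \<in> measurable M (count_space (Pow A))"
  proof (subst measurable_count_space_eq2, safe)
    fix C assume C: "C \<subseteq> A"
    have "(\<lambda>x. {a \<in> A. \<forall>b\<in>A. u x b \<le> u x a}) -` {C} \<inter> space M =
        {x \<in> space M. \<forall>a\<in>A. (\<forall>b\<in>A. u x b \<le> u x a) \<longleftrightarrow> a \<in> C}"
      using C by (auto simp: set_eq_iff)
    also have "\<dots> \<in> sets M" using A u by measurable
    finally show "(\<lambda>x. {a \<in> A. \<forall>b\<in>A. u x b \<le> u x a}) -` {C} \<inter> space M \<in> sets M" .
  qed (use A in auto)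
  from measurable_compose[OF this, of "\<lambda>C. SOME a. a \<in> C" "count_space UNIV"]
  show ?thesis by (simp add: argmax_on_def)
qed

locale noisy_instance = prob_space D for D :: "real measure" +
  fixes N :: "'a set" and f :: "'a set \<Rightarrow> real"
  assumes D_borel: "sets D = sets borel" and N: "finite N" and f: "monotone_submodular N f"
begin

abbreviation P where "P \<equiv> noise_space N D"
abbreviation v where "v \<omega> \<equiv> noisy_oracle \<omega> f"

sublocale P: prob_space P
  unfolding noise_space_def by (intro prob_space_PiM prob_space_axioms)

lemma noise_measurable: "X \<subseteq> N \<Longrightarrow> (\<lambda>\<omega>. \<omega> X) \<in> borel_measurable P"
  using measurable_component_singleton[of X "Pow N" "\<lambda>_. D"]
  by (simp add: noise_space_def measurable_cong_sets[OF refl D_borel])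

lemma estimate_measurable:
  assumes "T \<subseteq> N" "H \<subseteq> N"
  shows "(\<lambda>\<omega>. estimate H (v \<omega>) T) \<in> borel_measurable P"
proof -
  have "(\<lambda>\<omega>. max 0 (v \<omega> (T \<union> X))) \<in> borel_measurable P" if "X \<in> Pow H" for X
    using assms that noise_measurable[of "T \<union> X"] unfolding noisy_oracle_def by (intro borel_measurable_max) auto
  then show ?thesis
    unfolding estimate_def smooth_def by (intro borel_measurable_divide borel_measurable_sum) auto
qed

lemma greedy_step_measurable:
  assumes S: "S \<subseteq> N" and H: "H \<subseteq> N"
  shows "(\<lambda>\<omega>. greedy_step N H (v \<omega>) S) \<in> measurable P (count_space UNIV)"
proof (cases "N - H - S = {}")
  case False
  have "(\<lambda>\<omega>. argmax_on (N - H - S) (\<lambda>a. estimate H (v \<omega>) (insert a S))) \<in> measurable P (count_space UNIV)"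
    using S H N by (intro measurable_argmax_on estimate_measurable) auto
  from measurable_compose[OF this, of "\<lambda>a. insert a S" "count_space UNIV"] False
  show ?thesis by (simp add: greedy_step_def)
qed (simp add: greedy_step_def)

text \<open>The greedy set takes finitely many values, so the next step is piecewise a step from a
  fixed set, which is measurable.\<close>

lemma greedy_measurable:
  assumes H: "H \<subseteq> N"
  shows "(\<lambda>\<omega>. greedy N H (v \<omega>) t) \<in> measurable P (count_space (Pow N))"
proof -
  have range: "greedy N H w t \<in> Pow N" for t w using greedy_subset[OF N] by blast
  have "(\<lambda>\<omega>. greedy N H (v \<omega>) t) \<in> measurable P (count_space UNIV)"
  proof (induction t)
    case (Suc t)
    have "(\<lambda>\<omega>. greedy N H (v \<omega>) t) \<in> measurable P (count_space (Pow N))"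
      by (rule measurable_count_space_subset[OF Suc range])
    then show ?case
      unfolding greedy_Suc
      by (rule measurable_compose_countable'[rotated]) (use H N greedy_step_measurable in \<open>auto intro: countable_finite\<close>)
  qed simp
  then show ?thesis by (rule measurable_count_space_subset[OF _ range])
qed

text \<open>The list of runs takes finitely many values, and each fibre is a finite intersection of
  fibres of single runs; for a fixed list the selection is an argmax of measurable
  estimates.\<close>

lemma best_run_measurable:
  assumes Hs: "\<And>H. H \<in> set Hs \<Longrightarrow> H \<subseteq> N"
  shows "(\<lambda>\<omega>. best_run (v \<omega>) (map (\<lambda>H. (H, greedy N H (v \<omega>) t)) Hs)) \<in> measurable P (count_space UNIV)"
proof (rule measurable_compose_countable'[where f = "\<lambda>ps \<omega>. best_run (v \<omega>) ps"
      and g = "\<lambda>\<omega>. map (\<lambda>H. (H, greedy N H (v \<omega>) t)) Hs"])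
  let ?Y = "{ps. set ps \<subseteq> set Hs \<times> Pow N \<and> length ps = length Hs}"
  show fin: "countable ?Y"
    using N by (intro countable_finite finite_lists_length_eq) auto
  show "(\<lambda>\<omega>. best_run (v \<omega>) ps) \<in> measurable P (count_space UNIV)" if "ps \<in> ?Y" for ps
  proof -
    have "(\<lambda>\<omega>. argmax_on (set ps) (\<lambda>(H, S). estimate H (v \<omega>) S)) \<in> measurable P (count_space UNIV)"
    proof (rule measurable_argmax_on)
      fix p assume "p \<in> set ps"
      then have "p \<in> set Hs \<times> Pow N" using that by blast
      then have "fst p \<subseteq> N" "snd p \<subseteq> N" using Hs[of "fst p"] by auto
      then show "(\<lambda>\<omega>. case p of (H, S) \<Rightarrow> estimate H (v \<omega>) S) \<in> borel_measurable P"
        using estimate_measurable[of "snd p" "fst p"] by (simp add: case_prod_beta)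
    qed simp
    from measurable_compose[OF this, of "\<lambda>(H, S). S \<union> H" "count_space UNIV"]
    show ?thesis by (simp add: best_run_def)
  qed
  have "{\<omega> \<in> space P. map (\<lambda>H. (H, greedy N H (v \<omega>) t)) Hs = ps} \<in> sets P" for ps
    using Hs
  proof (induction Hs arbitrary: ps)
    case (Cons H Hs)
    show ?case
    proof (cases "\<exists>S ps'. ps = (H, S) # ps'")
      case True
      then obtain S ps' where ps: "ps = (H, S) # ps'" by blast
      have g: "(\<lambda>\<omega>. greedy N H (v \<omega>) t) -` {S} \<inter> space P \<in> sets P"
      proof (rule measurable_sets)
        show "(\<lambda>\<omega>. greedy N H (v \<omega>) t) \<in> measurable P (count_space UNIV)"
          using measurable_compose[OF greedy_measurable[of H t], of "\<lambda>x. x" "count_space UNIV"] Cons.prems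
          by simp
      qed simp
      have "{\<omega> \<in> space P. map (\<lambda>H. (H, greedy N H (v \<omega>) t)) (H # Hs) = ps} =
          ((\<lambda>\<omega>. greedy N H (v \<omega>) t) -` {S} \<inter> space P) \<inter>
          {\<omega> \<in> space P. map (\<lambda>H. (H, greedy N H (v \<omega>) t)) Hs = ps'}"
        by (auto simp: ps)
      then show ?thesis using g Cons by auto
    next
      case False
      then have "{\<omega> \<in> space P. map (\<lambda>H. (H, greedy N H (v \<omega>) t)) (H # Hs) = ps} = {}" by auto
      then show ?thesis by (metis sets.empty_sets)
    qed
  qed simp
  then have "(\<lambda>\<omega>. map (\<lambda>H. (H, greedy N H (v \<omega>) t)) Hs) -` {ps} \<inter> space P \<in> sets P" for ps
    by (simp add: vimage_def Int_def conj_commute)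
  moreover have "x \<in> N" if "x \<in> greedy N H w t" for x H w using greedy_subset[OF N] that by blast
  ultimately show "(\<lambda>\<omega>. map (\<lambda>H. (H, greedy N H (v \<omega>) t)) Hs) \<in> measurable P (count_space ?Y)"
    using N by (subst measurable_count_space_eq2) (auto intro: finite_lists_length_eq)
qed

section \<open>Independence of greedy stages and union bounds\<close>

lemma card_greedy_le: "card (greedy N H w t) \<le> t"
proof (induction t)
  case (Suc t)
  have "finite (greedy N H w t)"
    using greedy_subset[OF N, of H w t] N finite_subset by (metis finite_Diff)
  with Suc show ?case by (auto simp: greedy_Suc greedy_step_def card_insert_if)
qed simp

text \<open>The number of elements outside \<open>H\<close> records the stage at which a set can be
  queried: the first \<open>t\<close> steps never see more than \<open>t\<close> of them.\<close>

lemma greedy_local: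
  assumes H: "H \<subseteq> N" and eq: "\<And>X. X \<subseteq> N \<Longrightarrow> card (X - H) \<le> t \<Longrightarrow> \<omega> X = \<omega>' X"
  shows "greedy N H (v \<omega>) t = greedy N H (v \<omega>') t"
  using eq
proof (induction t)
  case (Suc t)
  define S where "S = greedy N H (v \<omega>) t"
  have S: "S \<subseteq> N - H" "card S \<le> t" unfolding S_def by (rule greedy_subset[OF N] card_greedy_le)+
  have IH: "greedy N H (v \<omega>') t = S" unfolding S_def using Suc by simp
  have "greedy_step N H (v \<omega>) S = greedy_step N H (v \<omega>') S"
  proof (rule greedy_step_cong)
    fix X assume "X \<in> step_queries N H S"
    then obtain a Y where X: "a \<in> N - H - S" "Y \<subseteq> H" "X = insert a S \<union> Y"
      by (auto simp: step_queries_def)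
    then have "X - H = insert a S" using S by auto
    moreover have "finite S" using S N finite_subset by (metis finite_Diff)
    ultimately have "card (X - H) \<le> Suc t" using S by (simp add: card_insert_if)
    moreover have "X \<subseteq> N" using X S H by auto
    ultimately show "v \<omega> X = v \<omega>' X" using Suc.prems by (simp add: noisy_oracle_def)
  qed
  then show ?case unfolding greedy_Suc IH S_def[symmetric] .
qed simp

definition bad :: "'a set \<Rightarrow> real \<Rightarrow> real \<Rightarrow> 'a set \<Rightarrow> ('a set \<Rightarrow> real) set" where
  "bad H \<mu> \<eta> T = {\<omega> \<in> space P. \<eta> < \<bar>estimate H (v \<omega>) T - \<mu> * smooth H f T\<bar>}"

lemma bad_sets: "T \<subseteq> N \<Longrightarrow> H \<subseteq> N \<Longrightarrow> bad H \<mu> \<eta> T \<in> sets P"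
  using estimate_measurable[of T H] unfolding bad_def by measurable

text \<open>The greedy set of size \<open>t\<close> depends only on queries with at most \<open>t\<close> elements outside \<open>H\<close>, while
  the estimates for its one-element extensions use queries with \<open>t + 1\<close> such elements; hence the
  adaptively chosen estimates are as reliable as estimates of fixed sets.\<close>

lemma adaptive_bad_prob:
  fixes p :: real
  assumes H: "H \<subseteq> N" and a: "a \<in> N - H" and p: "0 \<le> p"
    and bnd: "\<And>T. T \<subseteq> N - H \<Longrightarrow> card T = Suc t \<Longrightarrow> P.prob (bad H \<mu> \<eta> T) \<le> p"
    and t: "t \<le> card (N - H)"
  shows "P.prob {\<omega> \<in> space P. a \<notin> greedy N H (v \<omega>) t \<and> \<omega> \<in> bad H \<mu> \<eta> (insert a (greedy N H (v \<omega>) t))} \<le> p"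
    and "{\<omega> \<in> space P. a \<notin> greedy N H (v \<omega>) t \<and> \<omega> \<in> bad H \<mu> \<eta> (insert a (greedy N H (v \<omega>) t))} \<in> sets P"
proof -
  define U where "U S = (\<lambda>\<omega>. greedy N H (v \<omega>) t) -` {S} \<inter> space P" for S
  define \<S> where "\<S> = {S. S \<subseteq> N - H \<and> card S = t \<and> a \<notin> S}"
  have fin: "finite \<S>" unfolding \<S>_def using N by simp
  have U_sets: "U S \<in> sets P" if "S \<in> \<S>" for S
    unfolding U_def using that by (intro measurable_sets[OF greedy_measurable[OF H]]) (auto simp: \<S>_def)
  have bad: "bad H \<mu> \<eta> (insert a S) \<in> sets P" if "S \<in> \<S>" for S
    using that a H by (intro bad_sets) (auto simp: \<S>_def)
  \<comment> \<open>Splitting by the value \<open>S\<close> of the greedy set turns the random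
    candidate into a fixed one.\<close>
  have split: "{\<omega> \<in> space P. a \<notin> greedy N H (v \<omega>) t \<and> \<omega> \<in> bad H \<mu> \<eta> (insert a (greedy N H (v \<omega>) t))} =
      (\<Union>S\<in>\<S>. U S \<inter> bad H \<mu> \<eta> (insert a S))" (is "?E = _")
    using greedy_subset[OF N, of H] card_greedy[OF N t] by (auto simp: U_def \<S>_def)
  show "?E \<in> sets P" unfolding split using fin U_sets bad by (intro sets.finite_UN sets.Int) auto
  have "P.prob ?E \<le> (\<Sum>S\<in>\<S>. P.prob (U S \<inter> bad H \<mu> \<eta> (insert a S)))"
    unfolding split using fin U_sets bad by (intro P.finite_measure_subadditive_finite) auto
  also have "\<dots> \<le> (\<Sum>S\<in>\<S>. P.prob (U S) * p)"
  proof (rule sum_mono)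
    fix S assume S: "S \<in> \<S>"
    then have S': "S \<subseteq> N - H" "card S = t" "a \<notin> S" "finite S"
      using N by (auto simp: \<S>_def intro: finite_subset)
    have "P.prob (U S \<inter> bad H \<mu> \<eta> (insert a S)) = P.prob (U S) * P.prob (bad H \<mu> \<eta> (insert a S))"
      unfolding noise_space_def
    proof (rule measure_PiM_Int_disjoint_coordinates[where
          A = "{X. X \<subseteq> N \<and> card (X - H) \<le> t}" and B = "{insert a S \<union> X |X. X \<subseteq> H}"])
      have "insert a S \<union> X - H = insert a S" if "X \<subseteq> H" for X
        using that S' a by auto
      then show "{X. X \<subseteq> N \<and> card (X - H) \<le> t} \<inter> {insert a S \<union> X |X. X \<subseteq> H} = {}"
        using S' by auto
      show "U S \<in> sets (Pi\<^sub>M (Pow N) (\<lambda>_. D))" "bad H \<mu> \<eta> (insert a S) \<in> sets (Pi\<^sub>M (Pow N) (\<lambda>_. D))"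
        using U_sets[OF S] bad[OF S] by (auto simp: noise_space_def)
      show "\<omega>' \<in> U S" if "\<omega> \<in> U S" "\<omega>' \<in> space (Pi\<^sub>M (Pow N) (\<lambda>_. D))"
        "\<And>X. X \<in> {X. X \<subseteq> N \<and> card (X - H) \<le> t} \<Longrightarrow> \<omega> X = \<omega>' X" for \<omega> \<omega>'
        using that greedy_local[OF H, of t \<omega> \<omega>'] by (auto simp: U_def noise_space_def)
      show "\<omega>' \<in> bad H \<mu> \<eta> (insert a S)"
        if "\<omega> \<in> bad H \<mu> \<eta> (insert a S)" "\<omega>' \<in> space (Pi\<^sub>M (Pow N) (\<lambda>_. D))"
        "\<And>X. X \<in> {insert a S \<union> X |X. X \<subseteq> H} \<Longrightarrow> \<omega> X = \<omega>' X" for \<omega> \<omega>'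
      proof -
        have "estimate H (v \<omega>) (insert a S) = estimate H (v \<omega>') (insert a S)"
          using that(3) by (intro estimate_cong) (auto simp: noisy_oracle_def)
        then show ?thesis using that(1,2) by (simp add: bad_def noise_space_def)
      qed
    qed (use S' a H prob_space_axioms in auto)
    also have "\<dots> \<le> P.prob (U S) * p"
      using S' a by (intro mult_left_mono bnd) auto
    finally show "P.prob (U S \<inter> bad H \<mu> \<eta> (insert a S)) \<le> P.prob (U S) * p" .
  qed
  \<comment> \<open>The events \<open>U S\<close> are disjoint, so their probabilities sum to at
    most 1, and the number of possible greedy sets does not enter the bound.\<close>
  also have "\<dots> = P.prob (\<Union>S\<in>\<S>. U S) * p"
    using fin U_sets
    by (subst P.finite_measure_finite_Union) (auto simp: sum_distrib_right disjoint_family_on_def U_def)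
  also have "\<dots> \<le> 1 * p" using p by (intro mult_right_mono) auto
  finally show "P.prob ?E \<le> p" by simp
qed

text \<open>A union bound over steps and candidates. Exhibiting an exceptional event
  \<open>E\<close> avoids a measurability proof for \<open>accurate_run\<close>.\<close>

lemma inaccurate_run_prob:
  fixes p :: real
  assumes H: "H \<subseteq> N" and p: "0 \<le> p"
    and bnd: "\<And>T. T \<subseteq> N - H \<Longrightarrow> card T \<le> k \<Longrightarrow> P.prob (bad H \<mu> \<eta> T) \<le> p"
    and k: "k \<le> card (N - H)"
  shows "\<exists>E\<in>sets P. P.prob E \<le> k * card N * p \<and> (\<forall>\<omega>\<in>space P - E. accurate_run N H f (v \<omega>) \<mu> \<eta> k)"
proof
  let ?A = "\<lambda>t a. {\<omega> \<in> space P. a \<notin> greedy N H (v \<omega>) t \<and> \<omega> \<in> bad H \<mu> \<eta> (insert a (greedy N H (v \<omega>) t))}"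
  let ?E = "\<Union>t<k. \<Union>a\<in>N - H. ?A t a"
  have A: "P.prob (?A t a) \<le> p" "?A t a \<in> sets P" if "t < k" "a \<in> N - H" for t a
    using adaptive_bad_prob[OF H that(2) p, of t] bnd that k by auto
  have fin: "finite (N - H)" using N by simp
  show E: "?E \<in> sets P" using A fin by (intro sets.finite_UN) auto
  have "P.prob ?E \<le> (\<Sum>t<k. P.prob (\<Union>a\<in>N - H. ?A t a))"
    using A fin by (intro P.finite_measure_subadditive_finite) (auto intro!: sets.finite_UN)
  also have "\<dots> \<le> (\<Sum>t<k. \<Sum>a\<in>N - H. P.prob (?A t a))"
    using A fin by (intro sum_mono P.finite_measure_subadditive_finite) auto
  also have "\<dots> \<le> (\<Sum>t<k. \<Sum>a\<in>N - H. p)"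
    using A by (intro sum_mono) auto
  also have "\<dots> = k * card (N - H) * p" by simp
  also have "\<dots> \<le> k * card N * p"
    using p N by (intro mult_right_mono) (auto intro!: card_mono mult_left_mono)
  finally have "P.prob ?E \<le> k * card N * p" .
  moreover have "accurate_run N H f (v \<omega>) \<mu> \<eta> k" if "\<omega> \<in> space P - ?E" for \<omega>
    unfolding accurate_run_def
  proof (intro allI impI ballI)
    fix t a assume ta: "t < k" "a \<in> N - H - greedy N H (v \<omega>) t"
    then have "\<omega> \<notin> ?A t a" using that by blast
    then show "\<bar>estimate H (v \<omega>) (insert a (greedy N H (v \<omega>) t)) -
        \<mu> * smooth H f (insert a (greedy N H (v \<omega>) t))\<bar> \<le> \<eta>"
      using ta that by (auto simp: bad_def not_less)
  qed
  ultimately show "P.prob ?E \<le> k * card N * p \<and> (\<forall>\<omega>\<in>space P - ?E. accurate_run N H f (v \<omega>) \<mu> \<eta> k)"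
    by blast
qed

text \<open>The sets \<open>T \<union> X\<close> are pairwise distinct because \<open>T\<close>
  avoids \<open>H\<close>, so the estimate averages \<open>2 ^ card H\<close> independent
  multipliers with weights \<open>f (T \<union> X)\<close>. Nonnegative weights make cutting the
  noisy value at 0 the same as cutting the multiplier.\<close>

lemma bad_prob_le:
  fixes B \<delta> L :: real and j :: nat
  defines "\<mu> \<equiv> (LINT x|D. max 0 x)" and "K \<equiv> (LINT x|D. (max 0 x) ^ Suc j)"
  assumes H: "H \<subseteq> N" and T: "T \<subseteq> N - H" and B: "\<And>X. X \<subseteq> H \<Longrightarrow> f (T \<union> X) \<le> B" and B0: "0 \<le> B"
    and L: "0 < L" and \<delta>: "0 < \<delta>"
    and int1: "integrable D (\<lambda>x. max 0 x)" and intj: "integrable D (\<lambda>x. (max 0 x) ^ Suc j)"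
    and small: "K / L ^ j \<le> \<delta> / 2"
  shows "P.prob (bad H \<mu> (\<delta> * B) T) \<le> 2 ^ card H * (K / L ^ Suc j) + 2 * exp (- (2 ^ card H) * \<delta>\<^sup>2 / (2 * L\<^sup>2))"
proof -
  have K0: "0 \<le> K" unfolding K_def by (intro integral_nonneg_AE) auto
  have finH: "finite H" using finite_subset[OF H N] .
  have nonneg: "0 \<le> f (T \<union> X)" if "X \<subseteq> H" for X
    using that H T by (intro monotone_submodularD_nonneg[OF f]) auto
  define J where "J = (\<lambda>X. T \<union> X) ` Pow H"
  have inj: "inj_on (\<lambda>X. T \<union> X) (Pow H)" using T by (auto simp: inj_on_def)
  have cJ: "card J = 2 ^ card H"
    unfolding J_def using inj finH by (simp add: card_image card_Pow)
  have est: "estimate H (v \<omega>) T = (\<Sum>X\<in>J. max 0 (\<omega> X) * f X) / card J" for \<omega>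
  proof -
    have "max 0 (v \<omega> (T \<union> X)) = max 0 (\<omega> (T \<union> X)) * f (T \<union> X)" if "X \<in> Pow H" for X
      using nonneg[of X] that by (auto simp: noisy_oracle_def max_def zero_le_mult_iff mult_le_0_iff)
    then have "(\<Sum>X\<in>Pow H. max 0 (v \<omega> (T \<union> X))) = (\<Sum>X\<in>J. max 0 (\<omega> X) * f X)"
      unfolding J_def sum.reindex[OF inj] o_def by (rule sum.cong[OF refl])
    then show ?thesis by (simp add: estimate_def smooth_def cJ)
  qed
  have smo: "smooth H f T = (\<Sum>X\<in>J. f X) / card J"
    unfolding smooth_def cJ by (simp add: J_def sum.reindex[OF inj])
  have c: "0 < real (card J)" by (simp add: cJ)
  have bad_eq: "bad H \<mu> (\<delta> * B) T = {\<omega> \<in> space P.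
      real (card J) * \<delta> * B < \<bar>(\<Sum>X\<in>J. max 0 (\<omega> X) * f X) - \<mu> * (\<Sum>X\<in>J. f X)\<bar>}"
  proof -
    have "\<delta> * B < \<bar>x / real (card J) - \<mu> * (y / real (card J))\<bar> \<longleftrightarrow>
        real (card J) * \<delta> * B < \<bar>x - \<mu> * y\<bar>" for x y
    proof -
      have "\<bar>x / real (card J) - \<mu> * (y / real (card J))\<bar> = \<bar>x - \<mu> * y\<bar> / real (card J)"
        using c by (simp add: diff_divide_distrib[symmetric])
      then show ?thesis using c by (simp add: less_divide_eq mult_ac)
    qed
    then show ?thesis unfolding bad_def est smo by simp
  qed
  show ?thesis
  \<comment> \<open>The concentration bound needs a positive \<open>B\<close>; for
    \<open>B = 0\<close> all weights vanish and the estimate is exact.\<close>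
  proof (cases "B = 0")
    case True
    have "f X = 0" if X: "X \<in> J" for X
    proof -
      obtain Y where "Y \<subseteq> H" "X = T \<union> Y" using X by (auto simp: J_def)
      then show ?thesis using B[of Y] nonneg[of Y] True by simp
    qed
    then have "bad H \<mu> (\<delta> * B) T = {}" unfolding bad_eq using True by simp
    then show ?thesis using K0 L by (simp add: add_nonneg_nonneg)
  next
    case False
    then have "0 < B" using B0 by simp
    have "P.prob (bad H \<mu> (\<delta> * B) T) \<le>
        real (card J) * (K / L ^ Suc j) + 2 * exp (- real (card J) * \<delta>\<^sup>2 / (2 * L\<^sup>2))"
      unfolding bad_eq unfolding noise_space_def \<mu>_def K_def
    proof (rule weighted_noise_concentration)
      show "J \<subseteq> Pow N" using T H by (auto simp: J_def)
      show "finite J" "J \<noteq> {}" using finH by (auto simp: J_def)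
      show "0 \<le> f X" "f X \<le> B" if "X \<in> J" for X using that nonneg B by (auto simp: J_def)
      show "(LINT x|D. (max 0 x) ^ Suc j) / L ^ j \<le> \<delta> / 2" using small by (simp add: K_def)
    qed (use \<open>0 < B\<close> L \<delta> int1 intj D_borel prob_space_axioms in auto)
    then show ?thesis by (simp add: cJ)
  qed
qed

end

section \<open>The approximation guarantee\<close>

text \<open>\<open>e x\<close> is the least \<open>\<epsilon>\<close> with
  \<open>c_n * \<epsilon> powr (-4) \<le> x\<close>. The four conditions are, in order: a block is
  at most an \<epsilon> fraction of \<open>r\<close>; the blocks fit into the ground set; the bias
  of truncating at \<open>sqrt x\<close> is at most half of the tolerance \<open>e x / x\<close>;
  the union bound over runs, steps and candidates leaves at most \<open>1 / x\<^sup>2\<close>. With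
  the 20th moment, the Markov part of the last one is of order x^(-15/4).\<close>

lemma large_n_bounds:
  fixes c_n c_r K :: real
  assumes "0 < c_n" "0 < c_r" "0 < K"
  defines "e \<equiv> \<lambda>x. (c_n / x) powr (1 / 4)"
  shows "\<forall>\<^sub>F x in at_top. 4 * log 2 x \<le> e x * (c_r * x powr (1 / 3))"
    and "\<forall>\<^sub>F x in at_top. 2 / e x * (4 * log 2 x) \<le> x"
    and "\<forall>\<^sub>F x in at_top. K / sqrt x ^ 19 \<le> e x / x / 2"
    and "\<forall>\<^sub>F x in at_top. 2 / e x * x\<^sup>2 *
      (x ^ 4 * (K / sqrt x ^ 20) + 2 * exp (- ((x / 2) ^ 4) * (e x / x)\<^sup>2 / (2 * (sqrt x)\<^sup>2))) \<le> 1 / x\<^sup>2"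
  unfolding e_def using assms(1-3) by real_asymp+

text \<open>The size \<open>h\<close> of a block satisfies \<open>n\<^sup>4 / 16 \<le> 2\<^sup>h \<le> n\<^sup>4\<close>.\<close>

definition smoothed_greedy_alg :: "real \<Rightarrow> 'a set \<Rightarrow> nat \<Rightarrow> 'a query_alg" where
  "smoothed_greedy_alg \<epsilon> N r =
     (if 1 / 10 \<le> \<epsilon> then Return {}
      else if card N \<le> r then Return N
      else let h = 4 * floor_log (card N)
           in best_of_runs_alg N (r - h) (map (block N h) [0..<nat \<lceil>1 / \<epsilon>\<rceil>]))"

lemma holds_with_prob_always:
  assumes "prob_space M" "\<And>x. x \<in> space M \<Longrightarrow> P x" "p \<le> 1"
  shows "holds_with_prob M p P"
proof -
  have "{x \<in> space M. P x} = space M" using assms(2) by auto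
  then show ?thesis using assms(1,3) by (simp add: holds_with_prob_def prob_space.prob_space)
qed

text \<open>Meant for \<open>x = h / r\<close>, the price of making \<open>r - h\<close> instead of
  \<open>r\<close> steps. It is linear since \<open>exp x \<le> 1 + 2 * x\<close> on the unit
  interval and \<open>2 / exp 1 \<le> 1\<close>.\<close>

lemma greedy_loss_bound:
  fixes x :: real
  assumes "0 \<le> x" "x \<le> 1"
  shows "exp (x - 1) \<le> 1 / exp 1 + x"
proof -
  have "exp x \<le> 1 + x + x\<^sup>2" using assms by (intro exp_bound) auto
  also have "x\<^sup>2 \<le> x" using assms by (simp add: power2_eq_square mult_left_le)
  finally have "exp x \<le> 1 + 2 * x" by simp
  then have "exp (x - 1) \<le> (1 + 2 * x) / exp 1" by (simp add: exp_diff divide_right_mono)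
  also have "\<dots> = 1 / exp 1 + x * (2 / exp 1)" by (simp add: add_divide_distrib)
  also have "x * (2 / exp 1) \<le> x * 1"
    using assms exp_ge_add_one_self[of 1] by (intro mult_left_mono) auto
  finally show ?thesis by simp
qed

text \<open>The losses are \<epsilon> for the missing steps, \<epsilon> for the block taken from the
  optimum and 2\<epsilon> for the estimates. The constant 10 exceeds their sum so that the guarantee
  becomes vacuous from \<epsilon> = 1/10 on.\<close>

lemma approximation_factor_bound:
  fixes A B q \<epsilon> :: real
  assumes A: "1 - 1 / exp 1 - \<epsilon> \<le> A" "0 \<le> A" "A \<le> 1" and q: "q \<le> \<epsilon>" and B: "0 \<le> B" and \<epsilon>: "0 \<le> \<epsilon>"
  shows "(1 - 1 / exp 1 - 10 * \<epsilon>) * B \<le> A * ((1 - q) * B) - 2 * \<epsilon> * B"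
proof -
  have "A * q \<le> A * \<epsilon>" using A q by (intro mult_left_mono) auto
  also have "\<dots> \<le> \<epsilon>" using A \<epsilon> by (intro mult_left_le_one_le) auto
  finally have "1 - 1 / exp 1 - 10 * \<epsilon> \<le> A * (1 - q) - 2 * \<epsilon>"
    using A \<epsilon> by (simp only: right_diff_distrib mult_1_right)
  from mult_right_mono[OF this B] show ?thesis by (simp add: algebra_simps)
qed

text \<open>The tolerance is the optimum times \<open>\<epsilon> / card N\<close>, so at most
  \<open>card N\<close> comparisons cost at most 2\<epsilon> times the optimum. The blocks are fixed
  before any query, and a union bound over the \<open>m\<close> runs applies even though runs may
  share queries.\<close>

lemma (in noisy_instance) best_of_runs_prob:
  fixes \<epsilon> p \<mu> :: real and m h r :: nat
  defines "\<I> \<equiv> card_constraint N r"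
  assumes h: "h < r" "r < card N" "h \<le> \<epsilon> * r" and m: "1 / \<epsilon> \<le> m" "m * h \<le> card N"
    and \<epsilon>: "0 < \<epsilon>" "\<epsilon> < 1" and \<mu>: "1 \<le> \<mu>" and p: "0 \<le> p"
    and bnd: "\<And>H T. H \<subseteq> N \<Longrightarrow> card H = h \<Longrightarrow> T \<subseteq> N - H \<Longrightarrow> card T \<le> r - h \<Longrightarrow>
      P.prob (bad H \<mu> (\<epsilon> / card N * Max (f ` \<I>)) T) \<le> p"
  shows "holds_with_prob P (1 - m * ((r - h) * card N * p))
    (\<lambda>\<omega>. is_approximation (1 - 1 / exp 1 - 10 * \<epsilon>) \<I> f
      (alg_output (best_of_runs_alg N (r - h) (map (block N h) [0..<m])) (v \<omega>)))"
proof -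
  define B where "B = Max (f ` \<I>)"
  define \<eta> where "\<eta> = \<epsilon> / card N * B"
  let ?Hs = "map (block N h) [0..<m]"
  let ?out = "\<lambda>\<omega>. best_run (v \<omega>) (map (\<lambda>H. (H, greedy N H (v \<omega>) (r - h))) ?Hs)"
  let ?ok = "is_approximation (1 - 1 / exp 1 - 10 * \<epsilon>) \<I> f"
  have m0: "0 < m" using m(1) \<epsilon> by (cases m) (auto simp: not_le)
  note blk = block_subset[OF N m(2)] card_block[OF N m(2)]
  have Hs: "H \<subseteq> N" "card H = h" if "H \<in> set ?Hs" for H
    using that by (auto simp: blk) (use blk(1) in blast)
  have out: "alg_output (best_of_runs_alg N (r - h) ?Hs) (v \<omega>) = ?out \<omega>" for \<omega>
    by (rule best_of_runs_alg_correct(1)[OF N Hs])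
  have fin: "finite \<I>" "{} \<in> \<I>" using N by (auto simp: \<I>_def card_constraint_def)
  then have "B \<in> f ` \<I>" unfolding B_def by (intro Max_in) auto
  then obtain Q where Q: "Q \<subseteq> N" "card Q \<le> r" "f Q = B"
    by (auto simp: \<I>_def card_constraint_def)
  have B0: "0 \<le> B" using Q monotone_submodularD_nonneg[OF f] by blast
  have \<eta>0: "0 \<le> \<eta>" using \<epsilon> B0 by (simp add: \<eta>_def)
  have good: "?ok (?out \<omega>)"
    if acc: "\<And>i. i < m \<Longrightarrow> accurate_run N (block N h i) f (v \<omega>) \<mu> \<eta> (r - h)" for \<omega>
  proof -
    have r: "0 < r" using h by simp
    define A where "A = 1 - exp (- real (r - h) / real r)"
    have eq: "- real (r - h) / real r = real h / real r - 1"
      using h r by (simp add: of_nat_diff field_simps)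
    have hr: "real h / real r \<le> \<epsilon>" using h r by (simp add: field_simps)
    then have "exp (real h / real r - 1) \<le> 1 / exp 1 + real h / real r"
      using \<epsilon> by (intro greedy_loss_bound) auto
    with hr have A: "1 - 1 / exp 1 - \<epsilon> \<le> A" unfolding A_def eq by linarith
    have A01: "0 \<le> A" "A \<le> 1" by (auto simp: A_def)
    have "1 / m \<le> \<epsilon>" using m m0 \<epsilon> by (simp add: field_simps)
    then have "(1 - 1 / exp 1 - 10 * \<epsilon>) * B \<le> A * ((1 - 1 / m) * B) - 2 * \<epsilon> * B"
      using A A01 B0 \<epsilon> by (intro approximation_factor_bound) auto
    also have "2 * real (r - h + 1) * \<eta> \<le> 2 * \<epsilon> * B"
    proof -
      have "real (r - h + 1) * \<eta> \<le> card N * \<eta>"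
        using h \<eta>0 by (intro mult_right_mono) auto
      also have "\<dots> = \<epsilon> * B" using h by (simp add: \<eta>_def)
      finally show ?thesis by (simp only: mult.assoc)
    qed
    then have "A * ((1 - 1 / m) * B) - 2 * \<epsilon> * B \<le> A * ((1 - 1 / m) * B) - 2 * real (r - h + 1) * \<eta>"
      by simp
    also have "\<dots> \<le> f (?out \<omega>)"
      using accurate_runs_approximation[OF f N m0 m(2) h(1) _ acc \<mu> \<eta>0 Q(1,2)] h Q(3)
      by (simp add: A_def)
    finally have "(1 - 1 / exp 1 - 10 * \<epsilon>) * B \<le> f (?out \<omega>)" .
    moreover have "?out \<omega> \<in> \<I>"
      unfolding \<I>_def using h m0 Hs by (intro best_run_feasible[OF N]) auto
    ultimately show ?thesis by (simp add: is_approximation_def B_def)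
  qed
  have "\<exists>E\<in>sets P. P.prob E \<le> (r - h) * card N * p \<and>
      (\<forall>\<omega>\<in>space P - E. accurate_run N (block N h i) f (v \<omega>) \<mu> \<eta> (r - h))" if i: "i < m" for i
  proof (rule inaccurate_run_prob[OF blk(1)[OF i] p])
    show "P.prob (bad (block N h i) \<mu> \<eta> T) \<le> p" if "T \<subseteq> N - block N h i" "card T \<le> r - h" for T
      unfolding \<eta>_def B_def using that by (intro bnd blk i)
    have "card (N - block N h i) = card N - h"
      using blk[OF i] N finite_subset card_Diff_subset by metis
    then show "r - h \<le> card (N - block N h i)" using h by simp
  qed
  then obtain E where E: "\<And>i. i < m \<Longrightarrow> E i \<in> sets P"
    "\<And>i. i < m \<Longrightarrow> P.prob (E i) \<le> (r - h) * card N * p"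
    "\<And>i \<omega>. i < m \<Longrightarrow> \<omega> \<in> space P - E i \<Longrightarrow> accurate_run N (block N h i) f (v \<omega>) \<mu> \<eta> (r - h)"
    by metis
  have meas: "{\<omega> \<in> space P. ?ok (?out \<omega>)} \<in> sets P"
  proof -
    have "?out -` {S. ?ok S} \<inter> space P \<in> sets P"
      by (rule measurable_sets[OF best_run_measurable]) (use Hs in auto)
    then show ?thesis by (simp add: vimage_def Int_def conj_commute)
  qed
  have "P.prob (\<Union>i<m. E i) \<le> (\<Sum>i<m. P.prob (E i))"
    using E(1) by (intro P.finite_measure_subadditive_finite) auto
  also have "\<dots> \<le> (\<Sum>i<m. (r - h) * card N * p)"
    using E(2) by (intro sum_mono) auto
  finally have "1 - m * ((r - h) * card N * p) \<le> 1 - P.prob (\<Union>i<m. E i)" by simp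
  also have "\<dots> = P.prob (space P - (\<Union>i<m. E i))"
    using E(1) by (intro P.prob_compl[symmetric] sets.finite_UN) auto
  also have "\<dots> \<le> P.prob {\<omega> \<in> space P. ?ok (?out \<omega>)}"
  proof (rule P.finite_measure_mono[OF _ meas], rule subsetI)
    fix \<omega> assume \<omega>: "\<omega> \<in> space P - (\<Union>i<m. E i)"
    have "?ok (?out \<omega>)" by (rule good) (use \<omega> E(3) in blast)
    then show "\<omega> \<in> {\<omega> \<in> space P. ?ok (?out \<omega>)}" using \<omega> by blast
  qed
  finally show ?thesis
    using meas unfolding holds_with_prob_def out by simp
qed

lemma smoothing_exponent:
  assumes "0 < n"
  shows "(2::real) ^ (4 * floor_log n) \<le> real n ^ 4" and "(real n / 2) ^ 4 \<le> 2 ^ (4 * floor_log n)"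
    and "real (4 * floor_log n) \<le> 4 * log 2 (real n)"
proof -
  have up: "2 ^ floor_log n \<le> n" using floor_log_exp2_le[OF assms] .
  then have up': "(2::real) ^ floor_log n \<le> real n"
    by (metis of_nat_le_iff of_nat_numeral of_nat_power)
  have "n \<le> 2 * 2 ^ floor_log n" by (rule floor_log_exp2_ge)
  then have low: "real n / 2 \<le> 2 ^ floor_log n"
    using of_nat_mono[of n "2 * 2 ^ floor_log n", where 'a = real] by simp
  have eq: "(2::real) ^ (4 * floor_log n) = (2 ^ floor_log n) ^ 4"
    by (simp add: power_mult[symmetric] mult.commute)
  show "(2::real) ^ (4 * floor_log n) \<le> real n ^ 4" "(real n / 2) ^ 4 \<le> 2 ^ (4 * floor_log n)"
    unfolding eq using up' low by (intro power_mono; simp)+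
  show "real (4 * floor_log n) \<le> 4 * log 2 (real n)"
    using le_log2_of_power[OF up] by simp
qed

theorem theorem4p16:
  shows "\<exists>(alg :: real \<Rightarrow> 'a set \<Rightarrow> nat \<Rightarrow> 'a query_alg) C_apx C_prob C_query.
    0 < C_apx \<and> 0 < C_prob \<and> 0 < C_query \<and>
    (\<forall>D c_n c_r. noise_distribution D \<longrightarrow> (0::real) < c_n \<longrightarrow> (0::real) < c_r \<longrightarrow>
      (\<exists>n0::nat. \<forall>(\<epsilon>::real) (N :: 'a set) (n::nat) (r::nat).
         0 < \<epsilon> \<longrightarrow> finite N \<longrightarrow> card N = n \<longrightarrow> n0 \<le> n \<longrightarrow>
         c_n * \<epsilon> powr (-4) \<le> real n \<longrightarrow> c_r * real n powr (1/3) \<le> real r \<longrightarrow>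
         query_bounded N (C_query * (real n ^ 6 * \<epsilon> powr (-1))) (alg \<epsilon> N r) \<and>
         (\<forall>f. monotone_submodular N f \<longrightarrow>
            holds_with_prob (noise_space N D) (1 - C_prob * (1 / real n ^ 2))
              (\<lambda>\<xi>. is_approximation (1 - 1 / exp 1 - C_apx * \<epsilon>) (card_constraint N r) f
                     (alg_output (alg \<epsilon> N r) (noisy_oracle \<xi> f))))))"
proof -
  have main: "\<exists>n0::nat. \<forall>(\<epsilon>::real) (N :: 'a set) (n::nat) (r::nat).
         0 < \<epsilon> \<longrightarrow> finite N \<longrightarrow> card N = n \<longrightarrow> n0 \<le> n \<longrightarrow>
         c_n * \<epsilon> powr (-4) \<le> real n \<longrightarrow> c_r * real n powr (1/3) \<le> real r \<longrightarrow>
         query_bounded N (2 * (real n ^ 6 * \<epsilon> powr (-1))) (smoothed_greedy_alg \<epsilon> N r) \<and>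
         (\<forall>f. monotone_submodular N f \<longrightarrow>
            holds_with_prob (noise_space N D) (1 - 1 * (1 / real n ^ 2))
              (\<lambda>\<xi>. is_approximation (1 - 1 / exp 1 - 10 * \<epsilon>) (card_constraint N r) f
                     (alg_output (smoothed_greedy_alg \<epsilon> N r) (noisy_oracle \<xi> f))))"
    if noise: "noise_distribution D" and c_n: "0 < c_n" and c_r: "0 < c_r" for D :: "real measure" and c_n c_r :: real
  proof -
    define K where "K = (LINT x|D. (max 0 x) ^ Suc 19)"
    define \<mu> where "\<mu> = (LINT x|D. max 0 x)"
    define e where "e x = (c_n / x) powr (1 / 4)" for x :: real
    interpret D: prob_space D using noise by (simp add: noise_distribution_def)
    have D_borel: "sets D = sets borel" and int_id: "integrable D (\<lambda>x. x)" and mean: "(LINT x|D. x) = 1"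
      using noise by (auto simp: noise_distribution_def)
    have int1: "integrable D (\<lambda>x. max 0 x)"
      using noise_upper_moment[OF noise, of 1] by simp
    have int20: "integrable D (\<lambda>x. (max 0 x) ^ Suc 19)" by (rule noise_upper_moment[OF noise])
    have K0: "0 \<le> K" unfolding K_def by (intro integral_nonneg_AE) auto
    \<comment> \<open>The unit mean enters here: cutting off negative values can only raise
      it.\<close>
    have \<mu>1: "1 \<le> \<mu>"
      unfolding \<mu>_def mean[symmetric] using int_id int1 by (intro integral_mono) auto
    \<comment> \<open>\<open>K + 1\<close> is a positive bound for \<open>K\<close>, as the
      asymptotic conditions assume a positive constant.\<close>
    have "0 < K + 1" using K0 by simp
    note asym = large_n_bounds[OF c_n c_r this, folded e_def]
    have "\<forall>\<^sub>F n in sequentially. 2 \<le> n \<and>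
        4 * log 2 (real n) \<le> e n * (c_r * real n powr (1 / 3)) \<and>
        2 / e n * (4 * log 2 (real n)) \<le> real n \<and>
        (K + 1) / sqrt (real n) ^ 19 \<le> e n / real n / 2 \<and>
        2 / e n * (real n)\<^sup>2 * (real n ^ 4 * ((K + 1) / sqrt (real n) ^ 20) +
          2 * exp (- ((real n / 2) ^ 4) * (e n / real n)\<^sup>2 / (2 * (sqrt (real n))\<^sup>2))) \<le> 1 / (real n)\<^sup>2"
      by (intro eventually_conj eventually_ge_at_top asym[THEN eventually_compose_filterlim[OF _ filterlim_real_sequentially]])
    then obtain n0 where n0: "\<And>n. n0 \<le> n \<Longrightarrow> 2 \<le> n"
      "\<And>n. n0 \<le> n \<Longrightarrow> 4 * log 2 (real n) \<le> e n * (c_r * real n powr (1 / 3))"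
      "\<And>n. n0 \<le> n \<Longrightarrow> 2 / e n * (4 * log 2 (real n)) \<le> real n"
      "\<And>n. n0 \<le> n \<Longrightarrow> (K + 1) / sqrt (real n) ^ 19 \<le> e n / real n / 2"
      "\<And>n. n0 \<le> n \<Longrightarrow> 2 / e n * (real n)\<^sup>2 * (real n ^ 4 * ((K + 1) / sqrt (real n) ^ 20) +
          2 * exp (- ((real n / 2) ^ 4) * (e n / real n)\<^sup>2 / (2 * (sqrt (real n))\<^sup>2))) \<le> 1 / (real n)\<^sup>2"
      unfolding eventually_sequentially by blast
    show ?thesis
    proof (intro exI[of _ n0] allI impI)
      fix \<epsilon> :: real and N :: "'a set" and n r :: nat
      assume \<epsilon>0: "0 < \<epsilon>" and N: "finite N" and card_N: "card N = n" and n: "n0 \<le> n"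
        and n_\<epsilon>: "c_n * \<epsilon> powr (-4) \<le> real n" and r_n: "c_r * real n powr (1/3) \<le> real r"
      have n2: "2 \<le> n" by (rule n0(1)[OF n])
      have inst: "noisy_instance D N f" if "monotone_submodular N f" for f
        using that N D_borel D.prob_space_axioms by (simp add: noisy_instance_def noisy_instance_axioms_def)
      have fin: "finite (card_constraint N r)" "{} \<in> card_constraint N r"
        using N by (auto simp: card_constraint_def)
      have Max0: "0 \<le> Max (f ` card_constraint N r)" if "monotone_submodular N f" for f
        using that fin by (intro Max_ge) (auto simp: monotone_submodular_def intro!: image_eqI[of _ f "{}"])
      have prob_P: "prob_space (noise_space N D)"
        unfolding noise_space_def by (intro prob_space_PiM D.prob_space_axioms)
      consider (large_eps) "1 / 10 \<le> \<epsilon>" | (large_r) "\<epsilon> < 1 / 10" "n \<le> r" | (main) "\<epsilon> < 1 / 10" "r < n"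
        by linarith
      then show "query_bounded N (2 * (real n ^ 6 * \<epsilon> powr (-1))) (smoothed_greedy_alg \<epsilon> N r) \<and>
         (\<forall>f. monotone_submodular N f \<longrightarrow>
            holds_with_prob (noise_space N D) (1 - 1 * (1 / real n ^ 2))
              (\<lambda>\<xi>. is_approximation (1 - 1 / exp 1 - 10 * \<epsilon>) (card_constraint N r) f
                     (alg_output (smoothed_greedy_alg \<epsilon> N r) (noisy_oracle \<xi> f))))"
      proof cases
        \<comment> \<open>The target factor is nonpositive, so the empty set qualifies.\<close>
        case large_eps
        have "1 - 1 / exp 1 - 10 * \<epsilon> \<le> 0" using large_eps by (simp add: field_simps add_increasing)
        then have "is_approximation (1 - 1 / exp 1 - 10 * \<epsilon>) (card_constraint N r) f {}"
          if "monotone_submodular N f" for f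
          using Max0[OF that] that fin
          by (simp add: is_approximation_def monotone_submodular_def mult_nonpos_nonneg)
        then show ?thesis
          using large_eps by (auto simp: smoothed_greedy_alg_def query_bounded_def intro!: holds_with_prob_always[OF prob_P])
      next
        \<comment> \<open>The whole ground set is feasible and optimal by monotonicity; no query is
          made.\<close>
        case large_r
        have "is_approximation (1 - 1 / exp 1 - 10 * \<epsilon>) (card_constraint N r) f N"
          if f: "monotone_submodular N f" for f
        proof -
          have "(1 - 1 / exp 1 - 10 * \<epsilon>) * Max (f ` card_constraint N r) \<le> 1 * Max (f ` card_constraint N r)"
          proof (intro mult_right_mono)
              have "0 < 1 / exp (1::real)" by simp
              then show "1 - 1 / exp 1 - 10 * \<epsilon> \<le> 1" using \<epsilon>0 by linarith
          qed (rule Max0[OF f])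
          also have "\<dots> \<le> f N"
            using fin by (auto simp: card_constraint_def intro!: monotone_submodularD_mono[OF f] Max.boundedI)
          finally show ?thesis using large_r card_N by (simp add: is_approximation_def card_constraint_def)
        qed
        then show ?thesis
          using large_r card_N by (auto simp: smoothed_greedy_alg_def query_bounded_def intro!: holds_with_prob_always[OF prob_P])
      next
        case main
        define h where "h = 4 * floor_log n"
        define m where "m = nat \<lceil>1 / \<epsilon>\<rceil>"
        have alg: "smoothed_greedy_alg \<epsilon> N r = best_of_runs_alg N (r - h) (map (block N h) [0..<m])"
          using main card_N by (simp add: smoothed_greedy_alg_def h_def m_def Let_def)
        have "0 < n" using n2 by simp
        note pow = smoothing_exponent[OF this, folded h_def]
        have e_pos: "0 < e n" using c_n \<open>0 < n\<close> by (simp add: e_def)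
        have e_le: "e n \<le> \<epsilon>"
        proof -
          have "c_n / real n \<le> \<epsilon> powr 4"
            using n_\<epsilon> \<open>0 < n\<close> \<epsilon>0 by (simp add: powr_minus field_simps)
          then have "e n \<le> (\<epsilon> powr 4) powr (1 / 4)"
            unfolding e_def using c_n by (intro powr_mono2) auto
          also have "\<dots> = \<epsilon>" by (simp only: powr_powr) (use \<epsilon>0 in simp)
          finally show ?thesis .
        qed
        have r0: "0 < c_r * real n powr (1 / 3)" using c_r \<open>0 < n\<close> by simp
        have h_r: "real h \<le> \<epsilon> * r"
        proof -
          have "real h \<le> e n * (c_r * real n powr (1 / 3))"
            using pow(3) n0(2)[OF n] by linarith
          also have "\<dots> \<le> \<epsilon> * r" using e_le r_n e_pos r0 by (intro mult_mono) auto
          finally show ?thesis .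
        qed
        have "0 < r" using r0 r_n by (cases r) auto
        then have "\<epsilon> * real r < 1 * real r" using main by (intro mult_strict_right_mono) auto
        with h_r have "h < r" by simp
        have m_ge: "1 / \<epsilon> \<le> m" unfolding m_def by linarith
        have m_le: "m \<le> 2 / \<epsilon>"
        proof -
          have "m \<le> 1 / \<epsilon> + 1" unfolding m_def using \<epsilon>0 by (simp add: ceiling_correct)
          also have "\<dots> \<le> 2 / \<epsilon>" using main \<epsilon>0 by (simp add: field_simps)
          finally show ?thesis .
        qed
        \<comment> \<open>Bounding by \<open>e n\<close> instead of \<open>\<epsilon>\<close> leaves
          conditions on \<open>n\<close> alone, so that \<open>n0\<close> is uniform in
          \<open>\<epsilon>\<close>.\<close>
        have m_le_e: "m \<le> 2 / e n"
          using m_le e_le e_pos \<epsilon>0 divide_left_mono[of "e n" \<epsilon> 2] by simp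
        have fit: "m * h \<le> card N"
        proof -
          have "real m * real h \<le> 2 / e n * (4 * log 2 (real n))"
            using m_le_e pow(3) e_pos by (intro mult_mono) auto
          also have "\<dots> \<le> real n" by (rule n0(3)[OF n])
          finally show ?thesis unfolding card_N by (simp flip: of_nat_mult)
        qed
        have Hs: "H \<subseteq> N" "card H = h" if "H \<in> set (map (block N h) [0..<m])" for H
          using that by (auto simp: card_block[OF N fit]) (use block_subset[OF N fit] in blast)
        have "query_bounded N (2 * (real n ^ 6 * \<epsilon> powr (-1))) (smoothed_greedy_alg \<epsilon> N r)"
          unfolding query_bounded_def alg
        proof (intro allI conjI)
          fix w
          show "set (alg_queries (best_of_runs_alg N (r - h) (map (block N h) [0..<m])) w) \<subseteq> Pow N"
            by (rule best_of_runs_alg_correct(2)[OF N Hs])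
          have "length (alg_queries (best_of_runs_alg N (r - h) (map (block N h) [0..<m])) w)
              \<le> m * (((r - h) * n + 1) * 2 ^ h)"
            using best_of_runs_alg_correct(3)[OF N Hs] card_N by (metis length_map length_upt diff_zero)
          \<comment> \<open>Since \<open>r < n\<close>, there is room to absorb the extra summand of
            the final estimates.\<close>
          also have "\<dots> \<le> m * ((n * n) * 2 ^ h)"
          proof (intro mult_le_mono2 mult_le_mono1)
            have "(r - h) * n + 1 \<le> (n - 1) * n + n"
              using main(2) \<open>0 < n\<close> by (intro add_mono mult_le_mono1) auto
            also have "\<dots> = n * n" using \<open>0 < n\<close> by (cases n) auto
            finally show "(r - h) * n + 1 \<le> n * n" .
          qed
          finally have "real (length (alg_queries (best_of_runs_alg N (r - h) (map (block N h) [0..<m])) w))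
              \<le> real (m * ((n * n) * 2 ^ h))"
            by (simp only: of_nat_le_iff)
          also have "\<dots> = real m * (real n * real n * 2 ^ h)" by simp
          also have "\<dots> \<le> 2 / \<epsilon> * (real n * real n * real n ^ 4)"
            using m_le pow(1) \<epsilon>0 by (intro mult_mono) auto
          also have "\<dots> = 2 * (real n ^ 6 * \<epsilon> powr (-1))"
            using \<epsilon>0 by (simp add: powr_minus_divide field_simps power_numeral_reduce)
          finally show "real (length (alg_queries (best_of_runs_alg N (r - h) (map (block N h) [0..<m])) w))
              \<le> 2 * (real n ^ 6 * \<epsilon> powr (-1))" .
        qed
        moreover have "holds_with_prob (noise_space N D) (1 - 1 * (1 / real n ^ 2))
              (\<lambda>\<xi>. is_approximation (1 - 1 / exp 1 - 10 * \<epsilon>) (card_constraint N r) f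
                     (alg_output (smoothed_greedy_alg \<epsilon> N r) (noisy_oracle \<xi> f)))"
          if f: "monotone_submodular N f" for f
        proof -
          interpret noisy_instance D N f by (rule inst[OF f])
          define B where "B = Max (f ` card_constraint N r)"
          define \<delta> where "\<delta> = \<epsilon> / n"
          define L where "L = sqrt n"
          define p where "p = 2 ^ h * (K / L ^ Suc 19) + 2 * exp (- (2 ^ h) * \<delta>\<^sup>2 / (2 * L\<^sup>2))"
          have L0: "0 < L" and \<delta>0: "0 < \<delta>" using \<open>0 < n\<close> \<epsilon>0 by (auto simp: L_def \<delta>_def)
          have \<delta>_ge: "e n / real n \<le> \<delta>" unfolding \<delta>_def using e_le by (intro divide_right_mono) auto
          have small: "K / L ^ 19 \<le> \<delta> / 2"
          proof -
            have "K / L ^ 19 \<le> (K + 1) / L ^ 19" using L0 by (intro divide_right_mono) auto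
            also have "\<dots> \<le> e n / real n / 2" using n0(4)[OF n] by (simp add: L_def)
            also have "\<dots> \<le> \<delta> / 2" using \<delta>_ge by (rule divide_right_mono) simp
            finally show ?thesis .
          qed
          have p0: "0 \<le> p" unfolding p_def using K0 L0 by (intro add_nonneg_nonneg mult_nonneg_nonneg) auto
          have p_le: "p \<le> real n ^ 4 * ((K + 1) / sqrt (real n) ^ 20) +
              2 * exp (- ((real n / 2) ^ 4) * (e n / real n)\<^sup>2 / (2 * (sqrt (real n))\<^sup>2))"
            unfolding p_def
          proof (intro add_mono mult_left_mono mult_mono)
            show "K / L ^ Suc 19 \<le> (K + 1) / sqrt (real n) ^ 20"
              using L0 by (simp add: L_def divide_right_mono)
            have "(real n / 2) ^ 4 * (e n / real n)\<^sup>2 \<le> 2 ^ h * \<delta>\<^sup>2"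
              using pow(2) \<delta>_ge e_pos by (intro mult_mono power_mono) auto
            then show "exp (- (2 ^ h) * \<delta>\<^sup>2 / (2 * L\<^sup>2)) \<le>
                exp (- ((real n / 2) ^ 4) * (e n / real n)\<^sup>2 / (2 * (sqrt (real n))\<^sup>2))"
              unfolding L_def exp_le_cancel_iff by (intro divide_right_mono) auto
          qed (use pow K0 L0 in auto)
          have "holds_with_prob P (1 - m * ((r - h) * card N * p))
              (\<lambda>\<omega>. is_approximation (1 - 1 / exp 1 - 10 * \<epsilon>) (card_constraint N r) f
                (alg_output (smoothed_greedy_alg \<epsilon> N r) (v \<omega>)))"
            unfolding alg
          proof (rule best_of_runs_prob)
            show "P.prob (bad H \<mu> (\<epsilon> / card N * Max (f ` card_constraint N r)) T) \<le> p"
              if H: "H \<subseteq> N" "card H = h" and T: "T \<subseteq> N - H" "card T \<le> r - h" for H T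
            proof -
              have "f (T \<union> X) \<le> B" if X: "X \<subseteq> H" for X
              proof -
                have "card X \<le> h" using X H N by (metis card_mono finite_subset)
                then have "card (T \<union> X) \<le> r" using card_Un_le[of T X] T \<open>h < r\<close> by linarith
                then show ?thesis
                  unfolding B_def using fin X H T by (intro Max_ge) (auto simp: card_constraint_def)
              qed
              from bad_prob_le[OF H(1) T(1) this Max0[OF f, folded B_def] L0 \<delta>0 int1 int20]
              show ?thesis using small H(2) by (simp add: p_def B_def \<delta>_def \<mu>_def K_def card_N)
            qed
          qed (use \<open>h < r\<close> main card_N h_r m_ge fit \<epsilon>0 \<mu>1 p0 in auto)
          moreover have "m * ((r - h) * card N * p) \<le> 1 * (1 / real n ^ 2)"
          proof -
            have "m * ((r - h) * card N * p) \<le> 2 / e n * (real n * real n * p)"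
              unfolding card_N using m_le_e e_pos main(2) p0 by (intro mult_mono) auto
            also have "\<dots> = 2 / e n * (real n)\<^sup>2 * p" by (simp add: power2_eq_square)
            also have "\<dots> \<le> 2 / e n * (real n)\<^sup>2 * (real n ^ 4 * ((K + 1) / sqrt (real n) ^ 20) +
              2 * exp (- ((real n / 2) ^ 4) * (e n / real n)\<^sup>2 / (2 * (sqrt (real n))\<^sup>2)))"
              using p_le e_pos by (intro mult_left_mono) auto
            also have "\<dots> \<le> 1 / (real n)\<^sup>2" by (rule n0(5)[OF n])
            finally show ?thesis by simp
          qed
          ultimately show ?thesis
            unfolding holds_with_prob_def by linarith
        qed
        ultimately show ?thesis by blast
      qed
    qed
  qed
  show ?thesis
    by (intro exI[of _ smoothed_greedy_alg] exI[of _ 10] exI[of _ 1] exI[of _ 2] conjI allI impI main) auto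
qed

end
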